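(* Let $(\mathfrak g,\mathfrak h,\rho,D)$ be a relative difference Lie algebra, with brackets $\pi,\mu$ and $\Pi=\pi+\rho+\mu$. Define $C^1(\mathfrak g,\mathfrak h,\rho,D)=\mathrm{Hom}(\mathfrak g,\mathfrak g)\oplus\mathrm{Hom}(\mathfrak h,\mathfrak h)$ and, for $n\ge2$, $C^n(\mathfrak g,\mathfrak h,\rho,D)=\big(\mathrm{Hom}(\wedge^n\mathfrak g,\mathfrak g)\oplus\bigoplus_{i=1}^n\mathrm{Hom}(\wedge^{n-i}\mathfrak g\otimes\wedge^i\mathfrak h,\mathfrak h)\big)\oplus\mathrm{Hom}(\wedge^{n-1}\mathfrak g,\mathfrak h)$, and define $\delta:C^n\to C^{n+1}$ by $\delta(f,\theta)=(-1)^{n-2}l_1^{(s^{-1}\Pi,D)}(s^{-1}f,\theta)$, where an element $(s^{-1}f',\theta')$ of $s^{-1}\mathcal M\oplus F$ is identified with $(f',\theta')$. Then $(\bigoplus_{n\ge1}C^n(\mathfrak g,\mathfrak h,\rho,D),\delta)$ is a cochain complex, i.e. $\delta\circ\delta=0$.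
   Context: $L(V)=\bigoplus_{n\ge0}\mathrm{Hom}(\wedge^{n+1}V,V)$ with $\mathrm{Hom}(\wedge^{n+1}V,V)$ in degree $n$ ($|f|$), Nijenhuis–Richardson bracket $[f,g]_{NR}=f\circ g-(-1)^{(m-1)(n-1)}g\circ f$ for $f\in\mathrm{Hom}(\wedge^mV,V),g\in\mathrm{Hom}(\wedge^nV,V)$, where $(f\circ g)(v_1,\dots,v_{m+n-1})=\sum_{\sigma\in S(n,m-1)}\mathrm{sgn}(\sigma)f(g(v_{\sigma(1)},\dots,v_{\sigma(n)}),v_{\sigma(n+1)},\dots)$ ($S(p,q)$ shuffles). Maps $\wedge^k\mathfrak g\otimes\wedge^l\mathfrak h\to\mathfrak g$ or $\mathfrak h$ are identified with their lifts $\hat\kappa(x_1+u_1,\dots,x_{k+l}+u_{k+l})=\sum_{\tau\in S(k,l)}\mathrm{sgn}(\tau)\kappa(x_{\tau(1)},\dots,x_{\tau(k)},u_{\tau(k+1)},\dots,u_{\tau(k+l)})$ in $L(\mathfrak g\oplus\mathfrak h)$. $F=\bigoplus_{n\ge0}\mathrm{Hom}(\wedge^{n+1}\mathfrak g,\mathfrak h)$, $P$ the projection onto $F$, $\mathcal M=\bigoplus_{k\ge0}\big(\mathrm{Hom}(\wedge^{k+1}\mathfrak g,\mathfrak g)\oplus\bigoplus_{i+j=k+1,j\ge1}\mathrm{Hom}(\wedge^i\mathfrak g\otimes\wedge^j\mathfrak h,\mathfrak h)\big)$, $(s^{-1}W)^i=W^{i+1}$. The $L_\infty$-algebra $s^{-1}\mathcal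 M\oplus F$ has brackets $l_1(s^{-1}f,\theta)=P(f)$, $l_2(s^{-1}f,s^{-1}g)=(-1)^{|f|}s^{-1}[f,g]_{NR}$, $l_k(s^{-1}f,\theta_1,\dots,\theta_{k-1})=P[\cdots[f,\theta_1]_{NR}\cdots,\theta_{k-1}]_{NR}$ ($k\ge2$), plus graded-symmetric permutations, others zero; $(s^{-1}\Pi,D)$ is a Maurer–Cartan element, and the twisted brackets are $l_k^{\alpha}(x_1,\dots,x_k)=\sum_{n\ge0}\frac1{n!}l_{k+n}(\alpha,\dots,\alpha,x_1,\dots,x_k)$. A relative difference Lie algebra: Lie algebras $\mathfrak g,\mathfrak h$, an action $\rho:\mathfrak g\to\mathrm{Der}(\mathfrak h)$ (Lie algebra homomorphism), and linear $D:\mathfrak g\to\mathfrak h$ with $D[x,y]_{\mathfrak g}=\rho(x)D(y)-\rho(y)D(x)+[D(x),D(y)]_{\mathfrak h}$. *)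

theory Defs
  imports Main "HOL.Vector_Spaces" "HOL-Library.Product_Plus" "HOL-Library.Groups_Big_Fun"
begin

definition sgnv :: "nat \<Rightarrow> 'a::ab_group_add \<Rightarrow> 'a" where
  "sgnv k x = (if even k then x else - x)"

text \<open>A (p, N-p)-shuffle sigma is encoded by the set I = sigma({1..p}) (0-indexed) of
  positions of the first block; the second block is the (increasingly ordered) complement.\<close>
definition shuffles :: "nat \<Rightarrow> nat \<Rightarrow> nat set set" where
  "shuffles N p = {I. I \<subseteq> {0..<N} \<and> card I = p}"

definition shuffle_inv :: "nat \<Rightarrow> nat set \<Rightarrow> nat" where
  "shuffle_inv N I = card {(i, j). i \<in> I \<and> j \<in> {0..<N} - I \<and> j < i}"

section \<open>Nijenhuis--Richardson bracket on L(V) (elements of arity m = Hom(wedge^m V, V))\<close>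

definition nr_comp :: "nat \<Rightarrow> nat \<Rightarrow> ('v list \<Rightarrow> 'v) \<Rightarrow> ('v list \<Rightarrow> 'v) \<Rightarrow> 'v list \<Rightarrow> 'v::ab_group_add" where
  "nr_comp m n f g vs =
     (\<Sum>I\<in>shuffles (m + n - 1) n.
        sgnv (shuffle_inv (m + n - 1) I) (f (g (nths vs I) # nths vs ({0..<m + n - 1} - I))))"

definition nr :: "nat \<Rightarrow> nat \<Rightarrow> ('v list \<Rightarrow> 'v) \<Rightarrow> ('v list \<Rightarrow> 'v) \<Rightarrow> 'v list \<Rightarrow> 'v::ab_group_add" where
  "nr m n f g vs = nr_comp m n f g vs - sgnv ((m - 1) * (n - 1)) (nr_comp n m g f vs)"

definition lift_g :: "nat \<Rightarrow> nat \<Rightarrow> ('g list \<Rightarrow> 'h list \<Rightarrow> 'g) \<Rightarrow> ('g \<times> 'h) list \<Rightarrow> ('g::ab_group_add) \<times> ('h::ab_group_add)" where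
  "lift_g k l \<kappa> vs =
     (\<Sum>I\<in>shuffles (k + l) k. sgnv (shuffle_inv (k + l) I)
        (\<kappa> (map fst (nths vs I)) (map snd (nths vs ({0..<k + l} - I))), 0))"

definition lift_h :: "nat \<Rightarrow> nat \<Rightarrow> ('g list \<Rightarrow> 'h list \<Rightarrow> 'h) \<Rightarrow> ('g \<times> 'h) list \<Rightarrow> ('g::ab_group_add) \<times> ('h::ab_group_add)" where
  "lift_h k l \<kappa> vs =
     (\<Sum>I\<in>shuffles (k + l) k. sgnv (shuffle_inv (k + l) I)
        (0, \<kappa> (map fst (nths vs I)) (map snd (nths vs ({0..<k + l} - I)))))"

definition multilin :: "('k::field \<Rightarrow> 'a::ab_group_add \<Rightarrow> 'a) \<Rightarrow> ('k \<Rightarrow> 'b::ab_group_add \<Rightarrow> 'b)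
    \<Rightarrow> nat \<Rightarrow> ('a list \<Rightarrow> 'b) \<Rightarrow> bool" where
  "multilin sa sb m F \<longleftrightarrow>
     (\<forall>xs i a b x y. length xs = m \<longrightarrow> i < m \<longrightarrow>
        F (xs[i := sa a x + sa b y]) = sb a (F (xs[i := x])) + sb b (F (xs[i := y])))"

definition alternating :: "nat \<Rightarrow> ('a list \<Rightarrow> 'b::zero) \<Rightarrow> bool" where
  "alternating m F \<longleftrightarrow>
     (\<forall>xs i j. length xs = m \<longrightarrow> i < j \<longrightarrow> j < m \<longrightarrow> xs ! i = xs ! j \<longrightarrow> F xs = 0)"

definition hom2 :: "('k::field \<Rightarrow> 'a::ab_group_add \<Rightarrow> 'a) \<Rightarrow> ('k \<Rightarrow> 'b::ab_group_add \<Rightarrow> 'b)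
    \<Rightarrow> ('k \<Rightarrow> 'c::ab_group_add \<Rightarrow> 'c) \<Rightarrow> nat \<Rightarrow> nat \<Rightarrow> ('a list \<Rightarrow> 'b list \<Rightarrow> 'c) \<Rightarrow> bool" where
  "hom2 sa sb sc k l \<kappa> \<longleftrightarrow>
     (\<forall>us. length us = l \<longrightarrow> multilin sa sc k (\<lambda>xs. \<kappa> xs us) \<and> alternating k (\<lambda>xs. \<kappa> xs us)) \<and>
     (\<forall>xs. length xs = k \<longrightarrow> multilin sb sc l (\<kappa> xs) \<and> alternating l (\<kappa> xs))"

definition lie_algebra :: "('k::field \<Rightarrow> 'a::ab_group_add \<Rightarrow> 'a) \<Rightarrow> ('a \<Rightarrow> 'a \<Rightarrow> 'a) \<Rightarrow> bool" where
  "lie_algebra sc br \<longleftrightarrow> Vector_Spaces.vector_space sc \<and>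
     (\<forall>a b x y z. br (sc a x + sc b y) z = sc a (br x z) + sc b (br y z)) \<and>
     (\<forall>a b x y z. br z (sc a x + sc b y) = sc a (br z x) + sc b (br z y)) \<and>
     (\<forall>x. br x x = 0) \<and>
     (\<forall>x y z. br x (br y z) + br y (br z x) + br z (br x y) = 0)"

definition lie_action :: "('k::field \<Rightarrow> 'g::ab_group_add \<Rightarrow> 'g) \<Rightarrow> ('g \<Rightarrow> 'g \<Rightarrow> 'g)
    \<Rightarrow> ('k \<Rightarrow> 'h::ab_group_add \<Rightarrow> 'h) \<Rightarrow> ('h \<Rightarrow> 'h \<Rightarrow> 'h) \<Rightarrow> ('g \<Rightarrow> 'h \<Rightarrow> 'h) \<Rightarrow> bool" where
  "lie_action sg bg sh bh \<rho> \<longleftrightarrow>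
     (\<forall>x. Vector_Spaces.linear sh sh (\<rho> x)) \<and>
     (\<forall>a b x y u. \<rho> (sg a x + sg b y) u = sh a (\<rho> x u) + sh b (\<rho> y u)) \<and>
     (\<forall>x u v. \<rho> x (bh u v) = bh (\<rho> x u) v + bh u (\<rho> x v)) \<and>
     (\<forall>x y u. \<rho> (bg x y) u = \<rho> x (\<rho> y u) - \<rho> y (\<rho> x u))"

definition rel_diff_lie :: "('k::field \<Rightarrow> 'g::ab_group_add \<Rightarrow> 'g) \<Rightarrow> ('g \<Rightarrow> 'g \<Rightarrow> 'g)
    \<Rightarrow> ('k \<Rightarrow> 'h::ab_group_add \<Rightarrow> 'h) \<Rightarrow> ('h \<Rightarrow> 'h \<Rightarrow> 'h) \<Rightarrow> ('g \<Rightarrow> 'h \<Rightarrow> 'h) \<Rightarrow> ('g \<Rightarrow> 'h) \<Rightarrow> bool" where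
  "rel_diff_lie sg bg sh bh \<rho> D \<longleftrightarrow>
     lie_algebra sg bg \<and> lie_algebra sh bh \<and> lie_action sg bg sh bh \<rho> \<and> Vector_Spaces.linear sg sh D \<and>
     (\<forall>x y. D (bg x y) = \<rho> x (D y) - \<rho> y (D x) + bh (D x) (D y))"

definition PiL :: "('g \<Rightarrow> 'g \<Rightarrow> 'g) \<Rightarrow> ('h \<Rightarrow> 'h \<Rightarrow> 'h) \<Rightarrow> ('g \<Rightarrow> 'h \<Rightarrow> 'h)
    \<Rightarrow> ('g \<times> 'h) list \<Rightarrow> ('g::ab_group_add) \<times> ('h::ab_group_add)" where
  "PiL bg bh \<rho> vs = lift_g 2 0 (\<lambda>xs _. bg (xs ! 0) (xs ! 1)) vs
                  + lift_h 1 1 (\<lambda>xs us. \<rho> (xs ! 0) (us ! 0)) vs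
                  + lift_h 0 2 (\<lambda>_ us. bh (us ! 0) (us ! 1)) vs"

definition DL :: "('g \<Rightarrow> 'h) \<Rightarrow> ('g \<times> 'h) list \<Rightarrow> ('g::ab_group_add) \<times> ('h::ab_group_add)" where
  "DL D vs = lift_h 1 0 (\<lambda>xs _. D (xs ! 0)) vs"

text \<open>Projection P onto F = (+) Hom(wedge^{m} g, h), for an element of arity m
  (for multilinear maps this is the component with all inputs in g and output in h).\<close>
definition projF :: "(('g \<times> 'h) list \<Rightarrow> 'g \<times> 'h) \<Rightarrow> ('g \<times> 'h) list \<Rightarrow> ('g::ab_group_add) \<times> ('h::ab_group_add)" where
  "projF \<Phi> vs = (0, snd (\<Phi> (map (\<lambda>v. (fst v, 0)) vs)))"

definition adR :: "(('g \<times> 'h) list \<Rightarrow> 'g \<times> 'h) \<Rightarrow> nat \<Rightarrow> (('g \<times> 'h) list \<Rightarrow> 'g \<times> 'h)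
    \<Rightarrow> ('g \<times> 'h) list \<Rightarrow> ('g::ab_group_add) \<times> ('h::ab_group_add)" where
  "adR X a Y = nr a 1 Y X"

definition scaleV :: "('k \<Rightarrow> 'g \<Rightarrow> 'g) \<Rightarrow> ('k \<Rightarrow> 'h \<Rightarrow> 'h) \<Rightarrow> 'k \<Rightarrow> 'g \<times> 'h \<Rightarrow> 'g \<times> 'h" where
  "scaleV sg sh c v = (sg c (fst v), sh c (snd v))"

text \<open>delta(f, theta) = (-1)^(n-2) l_1^{(s^{-1}Pi, D)}(s^{-1} f, theta) on C^n, with
  l_1^{(s^{-1}Pi,D)}(s^{-1}f, theta) =
    ( - s^{-1}[Pi, f]_NR ,
      sum_N 1/N! P[..[f,D]..,D]  +  sum_M 1/M! P[[..[Pi,D]..,D], theta] )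
  (the theta-term is absent on C^1, which has no F-component).  The formal infinite
  sums are locally finite and are taken pointwise (Sum_any).\<close>
definition delta :: "('k::field_char_0 \<Rightarrow> 'g::ab_group_add \<Rightarrow> 'g) \<Rightarrow> ('k \<Rightarrow> 'h::ab_group_add \<Rightarrow> 'h)
    \<Rightarrow> ('g \<Rightarrow> 'g \<Rightarrow> 'g) \<Rightarrow> ('h \<Rightarrow> 'h \<Rightarrow> 'h) \<Rightarrow> ('g \<Rightarrow> 'h \<Rightarrow> 'h) \<Rightarrow> ('g \<Rightarrow> 'h) \<Rightarrow> nat
    \<Rightarrow> (('g \<times> 'h) list \<Rightarrow> 'g \<times> 'h) \<times> (('g \<times> 'h) list \<Rightarrow> 'g \<times> 'h)
    \<Rightarrow> (('g \<times> 'h) list \<Rightarrow> 'g \<times> 'h) \<times> (('g \<times> 'h) list \<Rightarrow> 'g \<times> 'h)" where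
  "delta sg sh bg bh \<rho> D n c =
     (let \<Pi> = PiL bg bh \<rho>; Dl = DL D; \<Phi> = fst c; \<Theta> = snd c in
      (\<lambda>vs. sgnv n (- nr 2 n \<Pi> \<Phi> vs),
       \<lambda>vs. sgnv n
         (Sum_any (\<lambda>N. scaleV sg sh (1 / fact N) (projF ((adR Dl n ^^ N) \<Phi>) vs))
          + (if 2 \<le> n
             then Sum_any (\<lambda>M. scaleV sg sh (1 / fact M)
                     (projF (nr 2 (n - 1) ((adR Dl 2 ^^ M) \<Pi>) \<Theta>) vs))
             else 0))))"

definition cochain :: "nat \<Rightarrow> ('g list \<Rightarrow> 'g) \<Rightarrow> (nat \<Rightarrow> 'g list \<Rightarrow> 'h list \<Rightarrow> 'h) \<Rightarrow> ('g list \<Rightarrow> 'h)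
    \<Rightarrow> (('g \<times> 'h) list \<Rightarrow> ('g::ab_group_add) \<times> ('h::ab_group_add)) \<times> (('g \<times> 'h) list \<Rightarrow> 'g \<times> 'h)" where
  "cochain n fg fh \<theta> =
     (\<lambda>vs. lift_g n 0 (\<lambda>xs _. fg xs) vs + (\<Sum>i = 1..n. lift_h (n - i) i (fh i) vs),
      lift_h (n - 1) 0 (\<lambda>xs _. \<theta> xs))"

end

theory Submission
  imports Defs
begin

text \<open>Up to sign, the bracket with \<open>\<Pi>\<close> is the Chevalley--Eilenberg differential of the semidirect
  product \<open>\<gg> \<ltimes> \<hh>\<close> with adjoint coefficients.  Since \<open>D\<close> squares to zero as an endomorphism \<open>E\<close> of
  \<open>\<gg> \<oplus> \<hh>\<close>, twisting by \<open>D\<close> is conjugation by \<open>1 + E\<close>, so that the F-component of \<open>f\<close> twisted by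
  \<open>D\<close> is \<open>q \<circ> f \<circ> \<phi>\<close> with \<open>\<phi> x = (x, D x)\<close> and \<open>q (x, u) = u - D x\<close>, while \<open>\<theta>\<close> is mapped to its
  Chevalley--Eilenberg differential for the action \<open>x \<cdot> u = \<rho> x u + [D x, u]\<close> of \<open>\<gg>\<close> on \<open>\<hh>\<close>.  The
  condition on \<open>D\<close> says that \<open>\<phi>\<close> is a Lie homomorphism and makes \<open>q\<close> equivariant along it, so
  \<open>f \<mapsto> q \<circ> f \<circ> \<phi>\<close> is a cochain map and \<open>\<delta>\<close> is, up to signs, the differential of its mapping cone.\<close>

section \<open>Shuffle sums\<close>

text \<open>The sum over shuffles by recursion on the list: the head joins the first or the second
  block. In the latter case all \<open>Suc k\<close> entries of the first block end up in front of
  it, which gives the sign. Both blocks keep their order by construction, so no index sets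
  remain.\<close>

fun shuffle_sum :: "nat \<Rightarrow> ('a list \<Rightarrow> 'a list \<Rightarrow> 'b) \<Rightarrow> 'a list \<Rightarrow> 'b::ab_group_add" where
  "shuffle_sum 0 F [] = F [] []"
| "shuffle_sum (Suc k) F [] = 0"
| "shuffle_sum 0 F (v # vs) = shuffle_sum 0 (\<lambda>a b. F a (v # b)) vs"
| "shuffle_sum (Suc k) F (v # vs) =
     shuffle_sum k (\<lambda>a b. F (v # a) b) vs
     + sgnv (Suc k) (shuffle_sum (Suc k) (\<lambda>a b. F a (v # b)) vs)"

lemma sgnv_simps [simp]:
  "sgnv 0 x = x" "sgnv (Suc k) x = - sgnv k x" "sgnv k 0 = 0"
  "sgnv k (sgnv k x) = x"
  "sgnv k (- x) = - sgnv k x"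
  by (auto simp: sgnv_def)

lemma sgnv_add: "sgnv k (x + y) = sgnv k x + sgnv k y"
  by (auto simp: sgnv_def)

lemma sgnv_diff: "sgnv k (x - y) = sgnv k x - sgnv k y"
  by (auto simp: sgnv_def)

lemma sgnv_sum: "sgnv k (sum f A) = (\<Sum>x\<in>A. sgnv k (f x))"
  by (auto simp: sgnv_def sum_negf)

lemma sgnv_add_exponent: "sgnv (j + k) x = sgnv j (sgnv k x)"
  by (auto simp: sgnv_def)

lemma snd_sgnv: "snd (sgnv k p) = sgnv k (snd p)"
  by (auto simp: sgnv_def)

section \<open>Shuffles split by the block that contains position 0\<close>

lemma finite_shuffles [simp]: "finite (shuffles N k)"
  by (rule finite_subset[of _ "Pow {0..<N}"]) (auto simp: shuffles_def)

text \<open>Position 0 in the first block exceeds no other position, so it enters no inversion, and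
  the shift by \<open>Suc\<close> preserves all the others.\<close>

lemma shuffle_inv_insert_0:
  assumes "J \<subseteq> {0..<N}"
  shows "shuffle_inv (Suc N) (insert 0 (Suc ` J)) = shuffle_inv N J"
proof -
  have "{(i, j). i \<in> insert 0 (Suc ` J) \<and> j \<in> {0..<Suc N} - insert 0 (Suc ` J) \<and> j < i}
      = map_prod Suc Suc ` {(i, j). i \<in> J \<and> j \<in> {0..<N} - J \<and> j < i}" (is "?L = ?R")
  proof (intro set_eqI iffI)
    fix p assume "p \<in> ?L"
    then obtain i j where p: "p = (i, j)" "i \<in> insert 0 (Suc ` J)" "j < Suc N"
        "j \<notin> insert 0 (Suc ` J)" "j < i" by auto
    then obtain i' j' where "i = Suc i'" "j = Suc j'" by (cases i; cases j) auto
    with p show "p \<in> ?R" by (auto intro!: image_eqI[of _ _ "(i', j')"])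
  qed (use assms in auto)
  then show ?thesis
    by (simp add: shuffle_inv_def card_image inj_on_def)
qed

text \<open>Here position 0 lies in the second block and forms an inversion with each of the
  \<open>card J\<close> positions of the first; these are the pairs
  \<open>(Suc i, 0)\<close>.\<close>

lemma shuffle_inv_Suc_image:
  assumes "J \<subseteq> {0..<N}"
  shows "shuffle_inv (Suc N) (Suc ` J) = card J + shuffle_inv N J"
proof -
  let ?S = "{(i, j). i \<in> J \<and> j \<in> {0..<N} - J \<and> j < i}"
  have fin: "finite J" using assms by (rule finite_subset) simp
  have "{(i, j). i \<in> Suc ` J \<and> j \<in> {0..<Suc N} - Suc ` J \<and> j < i}
      = (\<lambda>i. (Suc i, 0)) ` J \<union> map_prod Suc Suc ` ?S" (is "?L = ?R")
  proof (intro set_eqI iffI)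
    fix p assume "p \<in> ?L"
    then obtain i j where p: "p = (Suc i, j)" "i \<in> J" "j < Suc N" "j \<notin> Suc ` J" "j < Suc i" by auto
    then show "p \<in> ?R"
      by (cases j) (auto intro!: image_eqI[of _ _ "(i, j - 1)"])
  qed (use assms in auto)
  moreover have "finite ?S"
    by (rule finite_subset[of _ "J \<times> {0..<N}"]) (use fin in auto)
  moreover have "card ((\<lambda>i. (Suc i, 0::nat)) ` J \<union> map_prod Suc Suc ` ?S)
      = card ((\<lambda>i. (Suc i, 0::nat)) ` J) + card (map_prod Suc Suc ` ?S)"
    by (rule card_Un_disjoint) (use fin \<open>finite ?S\<close> in auto)
  ultimately show ?thesis
    by (simp add: shuffle_inv_def card_image inj_on_def)
qed

lemma Suc_image_vimage:
  "0 \<notin> I \<Longrightarrow> Suc ` {j. Suc j \<in> I} = I"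
  "0 \<in> I \<Longrightarrow> insert 0 (Suc ` {j. Suc j \<in> I}) = I"
  by (auto simp: image_iff) (metis not0_implies_Suc)+

lemma shuffles_with_0:
  "{I \<in> shuffles (Suc N) (Suc k). 0 \<in> I} = (\<lambda>J. insert 0 (Suc ` J)) ` shuffles N k"
proof (intro set_eqI iffI)
  fix I assume I: "I \<in> {I \<in> shuffles (Suc N) (Suc k). 0 \<in> I}"
  let ?J = "{j. Suc j \<in> I}"
  have eq: "insert 0 (Suc ` ?J) = I" using I by (intro Suc_image_vimage) simp
  have J: "?J \<subseteq> {0..<N}" using I by (auto simp: shuffles_def)
  then have "finite ?J" by (rule finite_subset) simp
  then have "card (insert 0 (Suc ` ?J)) = Suc (card ?J)"
    by (subst card_insert_disjoint) (auto simp: card_image)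
  then have "card ?J = k" using I eq by (simp add: shuffles_def)
  with J eq show "I \<in> (\<lambda>J. insert 0 (Suc ` J)) ` shuffles N k"
    by (intro image_eqI[of _ _ ?J]) (auto simp: shuffles_def)
next
  fix I assume "I \<in> (\<lambda>J. insert 0 (Suc ` J)) ` shuffles N k"
  then obtain J where J: "I = insert 0 (Suc ` J)" "J \<subseteq> {0..<N}" "card J = k"
    by (auto simp: shuffles_def)
  then have "finite J" by (meson finite_atLeastLessThan finite_subset)
  then have "card I = Suc k" using J by (subst J(1), subst card_insert_disjoint) (auto simp: card_image)
  with J show "I \<in> {I \<in> shuffles (Suc N) (Suc k). 0 \<in> I}" by (auto simp: shuffles_def)
qed

lemma shuffles_without_0:
  "{I \<in> shuffles (Suc N) k. 0 \<notin> I} = (`) Suc ` shuffles N k"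
proof (intro set_eqI iffI)
  fix I assume I: "I \<in> {I \<in> shuffles (Suc N) k. 0 \<notin> I}"
  let ?J = "{j. Suc j \<in> I}"
  have eq: "Suc ` ?J = I" using I by (intro Suc_image_vimage) simp
  have J: "?J \<subseteq> {0..<N}" using I by (auto simp: shuffles_def)
  have "card (Suc ` ?J) = card ?J" by (simp add: card_image)
  then have "card ?J = k" using I eq by (simp add: shuffles_def)
  with J eq show "I \<in> (`) Suc ` shuffles N k"
    by (intro image_eqI[of _ _ ?J]) (auto simp: shuffles_def)
qed (auto simp: shuffles_def card_image)

lemma shuffles_0: "shuffles N 0 = {{}}"
  by (auto simp: shuffles_def card_eq_0_iff dest: finite_subset)

text \<open>Induction on \<open>vs\<close>, splitting the shuffles by \<open>0 \<in> I\<close>; the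
  two inversion counts give the signs of the recursion. This turns the brackets and lifts, which are
  defined by sums over index sets, into list recursions.\<close>

lemma sum_shuffles_eq_shuffle_sum:
  fixes F :: "'a list \<Rightarrow> 'a list \<Rightarrow> 'b::ab_group_add"
  assumes "length vs = N"
  shows "(\<Sum>I\<in>shuffles N k. sgnv (shuffle_inv N I) (F (nths vs I) (nths vs ({0..<N} - I))))
         = shuffle_sum k F vs"
  using assms
proof (induction vs arbitrary: N k F)
  case Nil
  have "shuffles 0 k = (if k = 0 then {{}} else {})"
    by (auto simp: shuffles_def)
  with Nil show ?case
    by (cases k) (simp_all add: shuffle_inv_def)
next
  case (Cons v vs)
  define M where "M = length vs"
  have N: "N = Suc M" using Cons.prems by (simp add: M_def)
  have IH: "(\<Sum>I\<in>shuffles M k. sgnv (shuffle_inv M I) (G (nths vs I) (nths vs ({0..<M} - I))))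
         = shuffle_sum k G vs" for k and G :: "'a list \<Rightarrow> 'a list \<Rightarrow> 'b"
    by (rule Cons.IH) (simp add: M_def)
  let ?t = "\<lambda>I. sgnv (shuffle_inv N I) (F (nths (v # vs) I) (nths (v # vs) ({0..<N} - I)))"
  have compl: "{j. Suc j \<in> {0..<N} - Suc ` J} = {0..<M} - J"
    "{j. Suc j \<in> {0..<N} - insert 0 (Suc ` J)} = {0..<M} - J" for J
    by (auto simp: N)
  have t1: "?t (insert 0 (Suc ` J)) = sgnv (shuffle_inv M J) (F (v # nths vs J) (nths vs ({0..<M} - J)))"
    if "J \<in> shuffles M k" for J k
  proof -
    have "{j. Suc j \<in> insert 0 (Suc ` J)} = J" by auto
    then have "nths (v # vs) (insert 0 (Suc ` J)) = v # nths vs J"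
      unfolding nths_Cons by simp
    moreover have "nths (v # vs) ({0..<N} - insert 0 (Suc ` J)) = nths vs ({0..<M} - J)"
      unfolding nths_Cons compl by simp
    ultimately show ?thesis
      using that by (simp add: N shuffle_inv_insert_0 shuffles_def)
  qed
  have t2: "?t (Suc ` J) = sgnv k (sgnv (shuffle_inv M J) (F (nths vs J) (v # nths vs ({0..<M} - J))))"
    if "J \<in> shuffles M k" for J k
  proof -
    have "nths (v # vs) (Suc ` J) = nths vs J"
      by (simp add: nths_Cons image_iff)
    moreover have "nths (v # vs) ({0..<N} - Suc ` J) = v # nths vs ({0..<M} - J)"
      unfolding nths_Cons compl by (simp add: N)
    ultimately show ?thesis
      using that by (simp add: N shuffle_inv_Suc_image shuffles_def sgnv_add_exponent)
  qed
  have without: "sum ?t {I \<in> shuffles N k. 0 \<notin> I} = sgnv k (shuffle_sum k (\<lambda>a b. F a (v # b)) vs)" for k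
  proof -
    have "sum ?t {I \<in> shuffles N k. 0 \<notin> I} = (\<Sum>J\<in>shuffles M k. ?t (Suc ` J))"
      unfolding N shuffles_without_0
      by (subst sum.reindex) (auto simp: inj_on_def inj_image_eq_iff)
    also have "\<dots> = (\<Sum>J\<in>shuffles M k. sgnv k (sgnv (shuffle_inv M J) (F (nths vs J) (v # nths vs ({0..<M} - J)))))"
      by (rule sum.cong) (use t2 in auto)
    also have "\<dots> = sgnv k (shuffle_sum k (\<lambda>a b. F a (v # b)) vs)"
      by (simp only: IH[of "\<lambda>a b. F a (v # b)", symmetric] sgnv_sum)
    finally show ?thesis .
  qed
  show ?case
  proof (cases k)
    case 0
    have "{I \<in> shuffles N 0. 0 \<notin> I} = shuffles N 0" by (auto simp: shuffles_0)
    then show ?thesis using without[of 0] 0 by simp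
  next
    case (Suc k')
    have "sum ?t {I \<in> shuffles N k. 0 \<in> I} = (\<Sum>J\<in>shuffles M k'. ?t (insert 0 (Suc ` J)))"
      unfolding N Suc shuffles_with_0
      by (subst sum.reindex) (auto simp: inj_on_def inj_image_eq_iff insert_ident)
    also have "\<dots> = (\<Sum>J\<in>shuffles M k'. sgnv (shuffle_inv M J) (F (v # nths vs J) (nths vs ({0..<M} - J))))"
      by (rule sum.cong) (use t1 in auto)
    also have "\<dots> = shuffle_sum k' (\<lambda>a b. F (v # a) b) vs"
      by (rule IH[of "\<lambda>a b. F (v # a) b"])
    finally have "sum ?t {I \<in> shuffles N k. 0 \<in> I} = shuffle_sum k' (\<lambda>a b. F (v # a) b) vs" .
    moreover have "sum ?t (shuffles N k) = sum ?t {I \<in> shuffles N k. 0 \<in> I} + sum ?t {I \<in> shuffles N k. 0 \<notin> I}"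
      by (subst sum.union_disjoint[symmetric]) (auto intro!: sum.cong)
    ultimately show ?thesis using without[of k] Suc by simp
  qed
qed

section \<open>Formal rules for shuffle sums\<close>

lemma shuffle_sum_cong:
  assumes "\<And>a b. length a = k \<Longrightarrow> length b + k = length vs \<Longrightarrow> F a b = G a b"
  shows "shuffle_sum k F vs = shuffle_sum k G vs"
  using assms
proof (induction k F vs arbitrary: G rule: shuffle_sum.induct)
  case (3 F v vs)
  show ?case using 3 by simp
next
  case (4 k F v vs)
  have "shuffle_sum k (\<lambda>a. F (v # a)) vs = shuffle_sum k (\<lambda>a. G (v # a)) vs"
    by (rule "4.IH"(1)) (use "4.prems" in auto)
  moreover have "shuffle_sum (Suc k) (\<lambda>a b. F a (v # b)) vs = shuffle_sum (Suc k) (\<lambda>a b. G a (v # b)) vs"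
    by (rule "4.IH"(2)) (use "4.prems" in auto)
  ultimately show ?case by simp
qed auto

lemma additive_sgnv: "additive h \<Longrightarrow> h (sgnv k x) = sgnv k (h x)"
  by (simp add: sgnv_def additive.minus)

lemma shuffle_sum_additive:
  assumes "additive h"
  shows "shuffle_sum k (\<lambda>a b. h (F a b)) vs = h (shuffle_sum k F vs)"
  by (induction k F vs rule: shuffle_sum.induct)
     (simp_all add: additive.zero[OF assms] additive.add[OF assms] additive.diff[OF assms] additive_sgnv[OF assms])

lemma shuffle_sum_minus: "shuffle_sum k (\<lambda>a b. - F a b) vs = - shuffle_sum k F vs"
  by (rule shuffle_sum_additive) (simp add: additive_def)

lemma shuffle_sum_add:
  "shuffle_sum k (\<lambda>a b. F a b + G a b) vs = shuffle_sum k F vs + shuffle_sum k G vs"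
proof (induction k F vs arbitrary: G rule: shuffle_sum.induct)
  case (4 k F v vs)
  show ?case by (simp add: 4 sgnv_add)
qed auto

lemma shuffle_sum_gt_length: "length vs < k \<Longrightarrow> shuffle_sum k F vs = 0"
  by (induction k F vs rule: shuffle_sum.induct) auto

lemma shuffle_sum_length: "shuffle_sum (length vs) F vs = F vs []"
  by (induction vs arbitrary: F) (auto simp: shuffle_sum_gt_length)

lemma shuffle_sum_0: "shuffle_sum 0 F vs = F [] vs"
  by (induction vs arbitrary: F) auto

section \<open>The Chevalley--Eilenberg differential\<close>

fun multiadditive :: "nat \<Rightarrow> ('a::ab_group_add list \<Rightarrow> 'b::ab_group_add) \<Rightarrow> bool" where
  "multiadditive 0 f \<longleftrightarrow> True"
| "multiadditive (Suc n) f \<longleftrightarrow> (\<forall>zs. length zs = n \<longrightarrow> additive (\<lambda>x. f (x # zs))) \<and> (\<forall>x. multiadditive n (\<lambda>zs. f (x # zs)))"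

text \<open>Only neighbouring entries are exchanged; the recursion reaches every neighbouring pair,
  and these transpositions generate the symmetric group. Like \<open>multiadditive\<close>, this
  constrains \<open>f\<close> on lists of length \<open>n\<close> only, which is why both have
  congruence rules for that length.\<close>

fun skew :: "nat \<Rightarrow> ('a list \<Rightarrow> 'b::ab_group_add) \<Rightarrow> bool" where
  "skew 0 f \<longleftrightarrow> True"
| "skew (Suc n) f \<longleftrightarrow> (\<forall>x y zs. Suc (length zs) = n \<longrightarrow> f (x # y # zs) + f (y # x # zs) = 0)
     \<and> (\<forall>x. skew n (\<lambda>zs. f (x # zs)))"

lemma additive_uminus: "additive uminus"
  by (simp add: additive_def)

lemma additive_sgnv_fun: "additive (sgnv k)"
  by (simp add: additive_def sgnv_add)

lemma additive_comp: "additive g \<Longrightarrow> additive f \<Longrightarrow> additive (\<lambda>x. g (f x))"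
  by (simp add: additive_def)

lemma additive_plus: "additive f \<Longrightarrow> additive g \<Longrightarrow> additive (\<lambda>x. f x + g x)"
  by (simp add: additive_def algebra_simps)

lemma additive_diff: "additive f \<Longrightarrow> additive g \<Longrightarrow> additive (\<lambda>x. f x - g x)"
  by (simp add: additive_def algebra_simps)

lemma multiadditive_tail: "multiadditive n f \<Longrightarrow> multiadditive (n - Suc 0) (\<lambda>zs. f (x # zs))"
  by (cases n) auto

lemma multiadditive_add: "multiadditive n f \<Longrightarrow> n = Suc (length zs) \<Longrightarrow> f ((x + y) # zs) = f (x # zs) + f (y # zs)"
  by (simp add: additive_def)

lemma multiadditive_zero_front: "multiadditive n f \<Longrightarrow> n = Suc (length zs) \<Longrightarrow> f (0 # zs) = 0"
  using additive.zero[of "\<lambda>x. f (x # zs)"] by simp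

lemma skew_swap: "skew n f \<Longrightarrow> n = Suc (Suc (length zs)) \<Longrightarrow> f (x # y # zs) = - f (y # x # zs)"
  by (simp add: eq_neg_iff_add_eq_0)

lemma skew_SucI:
  assumes "\<And>x y zs. Suc (length zs) = n \<Longrightarrow> f (x # y # zs) = - f (y # x # zs)"
    and "\<And>x. skew n (\<lambda>zs. f (x # zs))"
  shows "skew (Suc n) f"
  using assms by (simp add: eq_neg_iff_add_eq_0)

lemma multiadditive_cong: "(\<And>zs. length zs = n \<Longrightarrow> f zs = g zs) \<Longrightarrow> multiadditive n f \<longleftrightarrow> multiadditive n g"
proof (induction n arbitrary: f g)
  case (Suc n)
  have "multiadditive n (\<lambda>zs. f (x # zs)) \<longleftrightarrow> multiadditive n (\<lambda>zs. g (x # zs))" for x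
    by (rule Suc.IH) (simp add: Suc.prems)
  then show ?case by (simp add: Suc.prems cong: imp_cong)
qed simp

lemma skew_cong: "(\<And>zs. length zs = n \<Longrightarrow> f zs = g zs) \<Longrightarrow> skew n f \<longleftrightarrow> skew n g"
proof (induction n arbitrary: f g)
  case (Suc n)
  have "skew n (\<lambda>zs. f (x # zs)) \<longleftrightarrow> skew n (\<lambda>zs. g (x # zs))" for x
    by (rule Suc.IH) (simp add: Suc.prems)
  then show ?case by (simp add: Suc.prems cong: imp_cong)
qed simp

lemma multiadditive_comp: "additive h \<Longrightarrow> multiadditive n f \<Longrightarrow> multiadditive n (\<lambda>zs. h (f zs))"
  by (induction n arbitrary: f) (auto simp: additive_def)

lemma skew_comp: "additive h \<Longrightarrow> skew n f \<Longrightarrow> skew n (\<lambda>zs. h (f zs))"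
  by (induction n arbitrary: f) (simp_all add: additive.add[of h, symmetric] additive.zero[of h])

lemma multiadditive_plus: "multiadditive n f \<Longrightarrow> multiadditive n g \<Longrightarrow> multiadditive n (\<lambda>zs. f zs + g zs)"
  by (induction n arbitrary: f g) (auto intro: additive_plus)

lemma skew_plus: "skew n f \<Longrightarrow> skew n g \<Longrightarrow> skew n (\<lambda>zs. f zs + g zs)"
proof (induction n arbitrary: f g)
  case (Suc n)
  show ?case
  proof (rule skew_SucI)
    show "f (x # y # zs) + g (x # y # zs) = - (f (y # x # zs) + g (y # x # zs))" if "Suc (length zs) = n" for x y zs
      using skew_swap[OF Suc.prems(1), of zs x y] skew_swap[OF Suc.prems(2), of zs x y] that by simp
    show "skew n (\<lambda>zs. f (x # zs) + g (x # zs))" for x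
      using Suc by simp
  qed
qed simp

lemma multiadditive_diff: "multiadditive n f \<Longrightarrow> multiadditive n g \<Longrightarrow> multiadditive n (\<lambda>zs. f zs - g zs)"
  using multiadditive_plus[of n f "\<lambda>zs. - g zs"] multiadditive_comp[OF additive_uminus, of n g] by simp

lemma skew_diff: "skew n f \<Longrightarrow> skew n g \<Longrightarrow> skew n (\<lambda>zs. f zs - g zs)"
  using skew_plus[of n f "\<lambda>zs. - g zs"] skew_comp[OF additive_uminus, of n g] by simp

lemma multiadditive_zero: "multiadditive n (\<lambda>_. 0)" by (induction n) (auto simp: additive_def)
lemma skew_zero: "skew n (\<lambda>_. 0)" by (induction n) auto

lemma multiadditive_sum: "(\<And>i. i \<in> A \<Longrightarrow> multiadditive n (f i)) \<Longrightarrow> multiadditive n (\<lambda>zs. \<Sum>i\<in>A. f i zs)"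
  by (induction A rule: infinite_finite_induct) (auto simp: multiadditive_zero multiadditive_plus)

lemma skew_sum: "(\<And>i. i \<in> A \<Longrightarrow> skew n (f i)) \<Longrightarrow> skew n (\<lambda>zs. \<Sum>i\<in>A. f i zs)"
  by (induction A rule: infinite_finite_induct) (auto simp: skew_zero skew_plus)

lemma multiadditive_map: "additive \<phi> \<Longrightarrow> multiadditive n f \<Longrightarrow> multiadditive n (\<lambda>zs. f (map \<phi> zs))"
proof (induction n arbitrary: f)
  case (Suc n)
  have "additive (\<lambda>x. f (\<phi> x # map \<phi> zs))" if "length zs = n" for zs
    by (rule additive_comp[of "\<lambda>x. f (x # map \<phi> zs)"]) (use Suc.prems that in auto)
  moreover have "multiadditive n (\<lambda>zs. f (\<phi> x # map \<phi> zs))" for x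
    using Suc.IH[of "\<lambda>zs. f (\<phi> x # zs)"] Suc.prems by simp
  ultimately show ?case by simp
qed simp

lemma skew_map: "skew n f \<Longrightarrow> skew n (\<lambda>zs. f (map \<phi> zs))"
proof (induction n arbitrary: f)
  case (Suc n)
  have "skew n (\<lambda>zs. f (\<phi> x # map \<phi> zs))" for x
    using Suc.IH[of "\<lambda>zs. f (\<phi> x # zs)"] Suc.prems by simp
  then show ?case using Suc.prems by simp
qed simp

text \<open>Precomposition with the derivation of the tensor algebra that extends
  \<open>\<phi>\<close>. For \<open>\<phi> = br x\<close> it is the argument part of the Lie
  derivative, for \<open>\<phi> = E\<close> the precomposition part of the bracket with
  \<open>D\<close>.\<close>

fun slot_sum :: "('a \<Rightarrow> 'a) \<Rightarrow> ('a list \<Rightarrow> 'b) \<Rightarrow> 'a list \<Rightarrow> 'b::ab_group_add" where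
  "slot_sum \<phi> f [] = 0"
| "slot_sum \<phi> f (y # ys) = f (\<phi> y # ys) + slot_sum \<phi> (\<lambda>zs. f (y # zs)) ys"

lemma slot_sum_cong: "(\<And>zs. length zs = length ys \<Longrightarrow> f zs = g zs) \<Longrightarrow> slot_sum \<phi> f ys = slot_sum \<phi> g ys"
proof (induction ys arbitrary: f g)
  case (Cons y ys)
  have "slot_sum \<phi> (\<lambda>zs. f (y # zs)) ys = slot_sum \<phi> (\<lambda>zs. g (y # zs)) ys"
    by (rule Cons.IH) (rule Cons.prems, simp)
  moreover have "f (\<phi> y # ys) = g (\<phi> y # ys)" by (rule Cons.prems) simp
  ultimately show ?case by simp
qed simp

lemma slot_sum_plus: "slot_sum \<phi> (\<lambda>zs. f zs + g zs) ys = slot_sum \<phi> f ys + slot_sum \<phi> g ys"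
  by (induction ys arbitrary: f g) auto

lemma slot_sum_zero: "slot_sum \<phi> (\<lambda>_. 0) ys = 0"
  by (induction ys) simp_all

lemma slot_sum_additive: "additive h \<Longrightarrow> slot_sum \<phi> (\<lambda>zs. h (f zs)) ys = h (slot_sum \<phi> f ys)"
  by (induction ys arbitrary: f) (simp_all add: additive.zero additive.add)

lemma slot_sum_minus: "slot_sum \<phi> (\<lambda>zs. - f zs) ys = - slot_sum \<phi> f ys"
  by (rule slot_sum_additive[OF additive_uminus])

lemma slot_sum_diff: "slot_sum \<phi> (\<lambda>zs. f zs - g zs) ys = slot_sum \<phi> f ys - slot_sum \<phi> g ys"
  using slot_sum_plus[of \<phi> f "\<lambda>zs. - g zs"] by (simp add: slot_sum_minus)

lemma slot_sum_plus_fun: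
  "multiadditive (length ys) f \<Longrightarrow> slot_sum (\<lambda>y. \<phi> y + \<psi> y) f ys = slot_sum \<phi> f ys + slot_sum \<psi> f ys"
proof (induction ys arbitrary: f)
  case (Cons y ys)
  then show ?case by (simp add: multiadditive_add[OF Cons.prems])
qed simp

text \<open>Replacements in different slots commute, so only those that hit the same slot twice
  survive in the commutator. The outer sum fills the slot first and the inner \<open>\<psi>\<close>
  then acts on \<open>\<phi> y\<close>, so composition is reversed.\<close>

lemma slot_sum_commutator:
  assumes "multiadditive (length ys) f" "\<And>y. \<psi> (\<phi> y) = \<phi> (\<psi> y) + \<chi> y"
  shows "slot_sum \<phi> (slot_sum \<psi> f) ys = slot_sum \<psi> (slot_sum \<phi> f) ys + slot_sum \<chi> f ys"
  using assms(1)
proof (induction ys arbitrary: f)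
  case (Cons y ys)
  have "f (\<psi> (\<phi> y) # ys) = f (\<phi> (\<psi> y) # ys) + f (\<chi> y # ys)"
    by (simp add: assms(2) multiadditive_add[OF Cons.prems])
  moreover have "slot_sum \<phi> (slot_sum \<psi> (\<lambda>zs. f (y # zs))) ys
      = slot_sum \<psi> (slot_sum \<phi> (\<lambda>zs. f (y # zs))) ys + slot_sum \<chi> (\<lambda>zs. f (y # zs)) ys"
    by (rule Cons.IH) (use Cons.prems in simp)
  ultimately show ?case by (simp add: slot_sum_plus)
qed simp

lemma multiadditive_slot_sum: "additive \<phi> \<Longrightarrow> multiadditive n f \<Longrightarrow> multiadditive n (slot_sum \<phi> f)"
proof (induction n arbitrary: f)
  case (Suc n)
  have "additive (\<lambda>x. slot_sum \<phi> (\<lambda>zs. f (x # zs)) zs)" if "length zs = n" for zs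
  proof (rule additive.intro)
    fix x y
    have "slot_sum \<phi> (\<lambda>zs. f ((x + y) # zs)) zs = slot_sum \<phi> (\<lambda>zs. f (x # zs) + f (y # zs)) zs"
      by (rule slot_sum_cong) (simp add: multiadditive_add[OF Suc.prems(2)] that)
    then show "slot_sum \<phi> (\<lambda>zs. f ((x + y) # zs)) zs
      = slot_sum \<phi> (\<lambda>zs. f (x # zs)) zs + slot_sum \<phi> (\<lambda>zs. f (y # zs)) zs"
      by (simp add: slot_sum_plus)
  qed
  moreover have "additive (\<lambda>x. f (\<phi> x # zs))" if "length zs = n" for zs
    by (rule additive_comp[of "\<lambda>x. f (x # zs)" \<phi>]) (use Suc.prems that in auto)
  moreover have "multiadditive n (\<lambda>zs. f (\<phi> x # zs) + slot_sum \<phi> (\<lambda>zs. f (x # zs)) zs)" for x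
    using Suc.prems by (intro multiadditive_plus Suc.IH) auto
  ultimately show ?case by (simp add: additive_plus)
qed simp

lemma skew_slot_sum: "skew n f \<Longrightarrow> skew n (slot_sum (\<phi> :: 'a \<Rightarrow> 'a) f)"
proof (induction n arbitrary: f)
  case (Suc n)
  show ?case
  proof (rule skew_SucI)
    fix x y :: 'a and zs :: "'a list" assume len: "Suc (length zs) = n"
    have sw: "f (x # y # zs') = - f (y # x # zs')" if "length zs' = length zs" for x y zs'
      by (rule skew_swap[OF Suc.prems]) (use len that in simp)
    have "slot_sum \<phi> (\<lambda>zs. f (x # y # zs)) zs = slot_sum \<phi> (\<lambda>zs. - f (y # x # zs)) zs"
      by (rule slot_sum_cong) (rule sw)
    then show "slot_sum \<phi> f (x # y # zs) = - slot_sum \<phi> f (y # x # zs)"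
      using sw[OF refl, of "\<phi> x" y] sw[OF refl, of x "\<phi> y"] by (simp add: slot_sum_minus)
  next
    show "skew n (\<lambda>zs. slot_sum \<phi> f (x # zs))" for x
      unfolding slot_sum.simps by (intro skew_plus Suc.IH) (use Suc.prems in simp_all)
  qed
qed simp

section \<open>The differential by recursion and its formal properties\<close>

text \<open>Cartan's formula \<open>\<iota>\<^sub>x d = L\<^sub>x - d \<iota>\<^sub>x\<close> read as a recursion.  On skew cochains this is the
  Chevalley--Eilenberg differential, and \<open>d d = 0\<close> reduces to \<open>L\<^sub>x d = d L\<^sub>x\<close>.\<close>
fun ce :: "('l \<Rightarrow> 'l \<Rightarrow> 'l) \<Rightarrow> ('l \<Rightarrow> 'm \<Rightarrow> 'm) \<Rightarrow> ('l list \<Rightarrow> 'm) \<Rightarrow> 'l list \<Rightarrow> 'm::ab_group_add" where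
  "ce br act f [] = 0"
| "ce br act f (x # xs) = act x (f xs) - slot_sum (br x) f xs - ce br act (\<lambda>zs. f (x # zs)) xs"

lemma ce_cong:
  "(\<And>zs. Suc (length zs) = length xs \<Longrightarrow> f zs = g zs) \<Longrightarrow> ce br act f xs = ce br act g xs"
proof (induction xs arbitrary: f g)
  case (Cons x xs)
  have "ce br act (\<lambda>zs. f (x # zs)) xs = ce br act (\<lambda>zs. g (x # zs)) xs"
    by (rule Cons.IH) (simp add: Cons.prems)
  moreover have "slot_sum (br x) f xs = slot_sum (br x) g xs"
    by (rule slot_sum_cong) (simp add: Cons.prems)
  ultimately show ?case by (simp add: Cons.prems)
qed simp

text \<open>The two compatibilities carry each term of the recursion along, with a change of Lie
  algebra along \<open>\<phi>\<close> and of coefficients along \<open>q\<close>. It serves twice: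
  for restriction to the graph of \<open>D\<close>, and for restricting the twisted bracket to
  \<gg>.\<close>

lemma ce_natural:
  assumes "additive q" "\<And>x y. br (\<phi> x) (\<phi> y) = \<phi> (br' x y)" "\<And>x m. q (act (\<phi> x) m) = act' x (q m)"
  shows "q (ce br act f (map \<phi> xs)) = ce br' act' (\<lambda>zs. q (f (map \<phi> zs))) xs"
proof (induction xs arbitrary: f)
  case (Cons x xs)
  have "q (slot_sum (br (\<phi> x)) f (map \<phi> xs)) = slot_sum (br' x) (\<lambda>zs. q (f (map \<phi> zs))) xs" for f
    by (induction xs arbitrary: f) (auto simp: assms(2) additive.zero[OF assms(1)] additive.add[OF assms(1)])
  then show ?case
    using Cons by (simp add: assms(3) additive.diff[OF assms(1)])
qed (simp add: additive.zero[OF assms(1)])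

lemma ce_plus:
  assumes "\<And>x. additive (act x)"
  shows "ce br act (\<lambda>zs. f zs + g zs) xs = ce br act f xs + ce br act g xs"
  by (induction xs arbitrary: f g) (auto simp: slot_sum_plus additive.add[OF assms])

lemma ce_additive:
  assumes "additive h" "\<And>x m. act x (h m) = h (act x m)"
  shows "ce br act (\<lambda>zs. h (f zs)) xs = h (ce br act f xs)"
  by (induction xs arbitrary: f)
     (auto simp: slot_sum_additive assms additive.zero[OF assms(1)] additive.diff[OF assms(1)])

lemma ce_minus:
  assumes "\<And>x. additive (act x)"
  shows "ce br act (\<lambda>zs. - f zs) xs = - ce br act f xs"
  by (rule ce_additive) (auto simp: additive_uminus additive.minus[OF assms])

lemma ce_diff:
  assumes "\<And>x. additive (act x)"
  shows "ce br act (\<lambda>zs. f zs - g zs) xs = ce br act f xs - ce br act g xs"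
  using ce_plus[OF assms, where f = f and g = "\<lambda>zs. - g zs"] by (simp add: ce_minus assms)

lemma ce_sgnv:
  assumes "\<And>x. additive (act x)"
  shows "ce br act (\<lambda>zs. sgnv k (f zs)) xs = sgnv k (ce br act f xs)"
  by (rule ce_additive) (auto simp: additive_sgnv_fun additive_sgnv[OF assms])

section \<open>Lie modules: the differential commutes with Lie derivatives and squares to
  zero\<close>

locale lie_module =
  fixes br :: "'l::ab_group_add \<Rightarrow> 'l \<Rightarrow> 'l" and act :: "'l \<Rightarrow> 'm::ab_group_add \<Rightarrow> 'm"
  assumes br_additive: "additive (br x)"
    and br_skew: "br x y = - br y x"
    and br_leibniz: "br x (br y z) = br (br x y) z + br y (br x z)"
    and act_additive: "additive (act x)"
    and act_additive_left: "additive (\<lambda>x. act x m)"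
    and act_br: "act (br x y) m = act x (act y m) - act y (act x m)"
begin

abbreviation "d \<equiv> ce br act"

abbreviation lie :: "'l \<Rightarrow> ('l list \<Rightarrow> 'm) \<Rightarrow> 'l list \<Rightarrow> 'm" where
  "lie x f \<equiv> \<lambda>zs. act x (f zs) - slot_sum (br x) f zs"

lemma br_additive_left: "additive (\<lambda>x. br x y)"
  using additive_comp[OF additive_uminus br_additive] by (simp add: br_skew[of _ y])

text \<open>The coefficient parts commute up to \<open>act (br x y)\<close> by
  \<open>act_br\<close>, the argument parts up to a bracket by the Jacobi identity, and the mixed
  terms cancel. As precomposition reverses the order, the argument parts produce
  \<open>br y x\<close>, whose sign accounts for the minus sign in \<open>lie\<close>.\<close>

lemma lie_bracket:
  assumes "multiadditive (length ys) f"
  shows "lie x (lie y f) ys = lie y (lie x f) ys + lie (br x y) f ys"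
proof -
  have "br y (br x z) = br x (br y z) + br (br y x) z" for z
    using br_leibniz[of y x z] by (simp add: add.commute)
  then have "slot_sum (br x) (slot_sum (br y) f) ys
      = slot_sum (br y) (slot_sum (br x) f) ys + slot_sum (br (br y x)) f ys"
    by (intro slot_sum_commutator assms) simp
  moreover have "slot_sum (br (br y x)) f ys = - slot_sum (br (br x y)) f ys"
  proof -
    have "slot_sum (\<lambda>z. br (br y x) z + br (br x y) z) f ys = slot_sum (\<lambda>z. 0) f ys"
      by (simp add: br_skew[of y x] additive.minus[OF br_additive_left])
    \<comment> \<open>Additivity for \<open>0 = 0 + 0\<close> shows that this sum equals twice
      itself.\<close>
    moreover have "slot_sum (\<lambda>z. 0) f ys = 0"
      using slot_sum_plus_fun[OF assms, of "\<lambda>_. 0" "\<lambda>_. 0"] by simp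
    ultimately show ?thesis
      using slot_sum_plus_fun[OF assms, of "br (br y x)" "br (br x y)"] by (simp add: eq_neg_iff_add_eq_0)
  qed
  ultimately show ?thesis
    by (simp add: slot_sum_diff slot_sum_additive[OF act_additive] additive.diff[OF act_additive] act_br)
qed

text \<open>Write i_y for insertion of \<open>y\<close> into the first slot. The Lie derivative L_x
  passes i_y at the cost of i_[x,y], and L_x L_y is L_y L_x + L_[x,y] by \<open>lie_bracket\<close>;
  the two occurrences of L_[x,y] cancel, and induction treats the rest.\<close>

lemma lie_d:
  assumes "multiadditive (length ys - Suc 0) f"
  shows "lie x (d f) ys = d (lie x f) ys"
  using assms
proof (induction ys arbitrary: f)
  case Nil
  then show ?case by (simp add: additive.zero[OF act_additive])
next
  case (Cons y ys)
  let ?fy = "\<lambda>zs. f (y # zs)"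
  have IH: "lie x (d ?fy) ys = d (lie x ?fy) ys"
    by (rule Cons.IH) (use Cons.prems in \<open>simp add: multiadditive_tail\<close>)
  have br: "lie x (lie y f) ys = lie y (lie x f) ys + lie (br x y) f ys"
    by (rule lie_bracket) (use Cons.prems in simp)
  \<comment> \<open>The slot of \<open>y\<close> in the Lie derivative contributes
    \<open>d f (br x y # ys)\<close>, which the recursion unfolds to the last parenthesis.\<close>
  have "lie x (d f) (y # ys) = lie x (\<lambda>zs. lie y f zs - d ?fy zs) ys - (lie (br x y) f ys - d (\<lambda>zs. f (br x y # zs)) ys)"
    by simp
  also have "lie x (\<lambda>zs. lie y f zs - d ?fy zs) ys = lie x (lie y f) ys - lie x (d ?fy) ys"
    by (simp add: slot_sum_diff additive.diff[OF act_additive])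
  finally have 1: "lie x (d f) (y # ys)
      = lie y (lie x f) ys - d (lie x ?fy) ys + d (\<lambda>zs. f (br x y # zs)) ys"
    unfolding IH br by simp
  have "d (lie x f) (y # ys) = lie y (lie x f) ys - d (\<lambda>zs. lie x ?fy zs - f (br x y # zs)) ys"
    by (simp add: algebra_simps)
  also have "d (\<lambda>zs. lie x ?fy zs - f (br x y # zs)) ys = d (lie x ?fy) ys - d (\<lambda>zs. f (br x y # zs)) ys"
    by (rule ce_diff[OF act_additive])
  finally have 2: "d (lie x f) (y # ys)
      = lie y (lie x f) ys - (d (lie x ?fy) ys - d (\<lambda>zs. f (br x y # zs)) ys)" .
  show ?case unfolding 1 2 by simp
qed

text \<open>Applying i_x d = L_x - d i_x twice gives i_x d d = L_x d - d L_x + d d i_x. The first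
  two terms cancel by \<open>lie_d\<close>, and the third has one argument fewer.\<close>

lemma d_d: "multiadditive (length xs - 2) f \<Longrightarrow> d (d f) xs = 0"
proof (induction xs arbitrary: f)
  case (Cons x xs)
  have "d (d f) (x # xs) = lie x (d f) xs - d (\<lambda>zs. lie x f zs - d (\<lambda>zs. f (x # zs)) zs) xs"
    by simp
  also have "\<dots> = lie x (d f) xs - d (lie x f) xs + d (d (\<lambda>zs. f (x # zs))) xs"
    by (subst ce_diff[OF act_additive]) simp
  also have "d (d (\<lambda>zs. f (x # zs))) xs = 0"
  proof (rule Cons.IH)
    show "multiadditive (length xs - 2) (\<lambda>zs. f (x # zs))"
      using multiadditive_tail[OF Cons.prems] by (simp add: numeral_2_eq_2)
  qed
  also have "lie x (d f) xs = d (lie x f) xs"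
    by (rule lie_d) (use Cons.prems in \<open>simp add: numeral_2_eq_2\<close>)
  finally show ?case by simp
qed simp

lemma multiadditive_lie: "multiadditive n f \<Longrightarrow> multiadditive n (lie x f)"
  by (intro multiadditive_diff multiadditive_comp[OF act_additive] multiadditive_slot_sum[OF br_additive])

lemma skew_lie: "skew n f \<Longrightarrow> skew n (lie x f)"
  by (intro skew_diff skew_comp[OF act_additive] skew_slot_sum)

lemma additive_d_front:
  assumes "\<And>zs. Suc (length zs) = length xs \<Longrightarrow> additive (\<lambda>x. f x zs)"
  shows "additive (\<lambda>x. d (f x) xs)"
proof (rule additive.intro)
  fix x y
  have "d (f (x + y)) xs = d (\<lambda>zs. f x zs + f y zs) xs"
    by (rule ce_cong) (simp add: additive.add[OF assms])
  then show "d (f (x + y)) xs = d (f x) xs + d (f y) xs"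
    by (simp add: ce_plus[OF act_additive])
qed

lemma multiadditive_d: "multiadditive n f \<Longrightarrow> multiadditive (Suc n) (d f)"
proof (induction n arbitrary: f)
  case 0
  then show ?case by (simp add: additive_diff act_additive_left additive.add[OF act_additive_left] additive_def)
next
  case (Suc n)
  have "additive (\<lambda>x. d f (x # zs))" if "length zs = Suc n" for zs
  proof -
    have "additive (\<lambda>x. d (\<lambda>zs. f (x # zs)) zs)"
      by (rule additive_d_front) (use Suc.prems that in simp)
    moreover have "additive (\<lambda>x. slot_sum (br x) f zs)"
    proof (rule additive.intro)
      have "br (x + y) = (\<lambda>z. br x z + br y z)" for x y
        by (rule ext) (rule additive.add[OF br_additive_left])
      then      show "slot_sum (br (x + y)) f zs = slot_sum (br x) f zs + slot_sum (br y) f zs" for x y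
        using slot_sum_plus_fun[of zs f "br x" "br y"] Suc.prems that
        by simp
    qed
    ultimately show ?thesis by (simp add: additive_diff act_additive_left)
  qed
  moreover have "multiadditive (Suc n) (\<lambda>zs. lie x f zs - d (\<lambda>zs. f (x # zs)) zs)" for x
    by (intro multiadditive_diff[OF multiadditive_lie] Suc.IH Suc.prems) (use Suc.prems in simp)
  ultimately show ?case by (subst multiadditive.simps) simp
qed

text \<open>Unfolding the recursion twice shows the effect of the front transposition: the two
  \<open>act\<close> terms trade places with opposite signs, so do the two \<open>slot_sum\<close>
  terms, \<open>f (br x y # zs)\<close> changes sign by \<open>br_skew\<close>, and the last term
  does by skewness of \<open>f\<close>. Later transpositions follow by induction, since Lie
  derivatives preserve skewness.\<close>

lemma skew_d: "multiadditive n f \<Longrightarrow> skew n f \<Longrightarrow> skew (Suc n) (d f)"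
proof (induction n arbitrary: f)
  case 0
  then show ?case by simp
next
  case (Suc n)
  show ?case
  proof (rule skew_SucI)
    fix x y and zs :: "'l list" assume len: "Suc (length zs) = Suc n"
    have sw: "f (x # y # zs') = - f (y # x # zs')" if "Suc (length zs') = length zs" for x y zs'
      by (rule skew_swap[OF Suc.prems(2)]) (use len that in simp)
    have "d (\<lambda>zs. f (x # y # zs)) zs = d (\<lambda>zs. - f (y # x # zs)) zs"
      by (rule ce_cong) (rule sw)
    then have *: "d (\<lambda>zs. f (x # y # zs)) zs = - d (\<lambda>zs. f (y # x # zs)) zs"
      by (simp add: ce_minus[OF act_additive])
    have "additive (\<lambda>x. f (x # zs))" using Suc.prems(1) len by simp
    then have "f (- br x y # zs) = - f (br x y # zs)"
      by (rule additive.minus)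
    then have "f (br y x # zs) = - f (br x y # zs)"
      by (simp only: br_skew[of y x])
    with * show "d f (x # y # zs) = - d f (y # x # zs)"
      by (simp add: additive.diff[OF act_additive] additive.add[OF act_additive] algebra_simps)
  next
    show "skew (Suc n) (\<lambda>zs. d f (x # zs))" for x
      unfolding ce.simps by (intro skew_diff[OF skew_lie] Suc.IH Suc.prems) (use Suc.prems in simp_all)
  qed
qed

end

section \<open>Nijenhuis--Richardson brackets\<close>

lemma nr_comp_eq_shuffle_sum:
  "length vs = m + n - 1 \<Longrightarrow> nr_comp m n f g vs = shuffle_sum n (\<lambda>a b. f (g a # b)) vs"
  unfolding nr_comp_def by (rule sum_shuffles_eq_shuffle_sum)

text \<open>The shuffle sign for pulling one entry to the front cancels the sign that
  \<open>f\<close> picks up when the entry is moved back into its slot.\<close>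

lemma shuffle_sum_1_eq_slot_sum:
  "skew (length vs) f \<Longrightarrow> shuffle_sum (Suc 0) (\<lambda>a b. f (P a # b)) vs = slot_sum (\<lambda>y. P [y]) f vs"
proof (induction vs arbitrary: f)
  case (Cons v vs)
  have "shuffle_sum (Suc 0) (\<lambda>a b. f (P a # v # b)) vs = shuffle_sum (Suc 0) (\<lambda>a b. - f (v # P a # b)) vs"
    by (rule shuffle_sum_cong, rule skew_swap[OF Cons.prems]) simp
  also have "\<dots> = - slot_sum (\<lambda>y. P [y]) (\<lambda>zs. f (v # zs)) vs"
    by (subst shuffle_sum_minus, subst Cons.IH) (use Cons.prems in simp_all)
  finally show ?case by (simp add: shuffle_sum_0)
qed simp

text \<open>Induction on \<open>vs\<close>, by the place of the head \<open>v\<close>. If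
  \<open>v\<close> enters the inner \<open>P\<close> with one other entry, the terms add up to
  \<open>slot_sum (br v) f vs\<close>; if \<open>v\<close> is the only entry outside the inner
  \<open>f\<close>, they give the adjoint action. In all remaining terms \<open>v\<close> becomes
  the first argument of \<open>f\<close>, which is the last term of \<open>ce\<close>.\<close>

lemma ce_eq_shuffle_sums:
  assumes "\<And>x y. P [x, y] = br x y" "\<And>x y. br x y = - br y x"
    and "length vs = Suc n" "skew n f"
  shows "sgnv (Suc n) (shuffle_sum n (\<lambda>a b. P (f a # b)) vs) - shuffle_sum 2 (\<lambda>a b. f (P a # b)) vs
       = ce br br f vs"
  using assms(3,4)
proof (induction vs arbitrary: n f)
  case (Cons v vs)
  then have len: "length vs = n" by simp
  have slot: "shuffle_sum (Suc 0) (\<lambda>a b. f (P (v # a) # b)) vs = slot_sum (br v) f vs"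
    using shuffle_sum_1_eq_slot_sum[of vs f "\<lambda>a. P (v # a)"] Cons.prems len by (simp add: assms(1))
  have 2: "shuffle_sum 2 (\<lambda>a b. f (P a # b)) (v # vs)
      = slot_sum (br v) f vs - shuffle_sum 2 (\<lambda>a b. f (v # P a # b)) vs"
  proof -
    have "shuffle_sum 2 (\<lambda>a b. f (P a # v # b)) vs = shuffle_sum 2 (\<lambda>a b. - f (v # P a # b)) vs"
    proof (rule shuffle_sum_cong)
      fix a b :: "'a list" assume "length b + 2 = length vs"
      then have "n = Suc (Suc (length b))" using len by simp
      then show "f (P a # v # b) = - f (v # P a # b)" by (rule skew_swap[OF Cons.prems(2)])
    qed
    also have "\<dots> = - shuffle_sum 2 (\<lambda>a b. f (v # P a # b)) vs" by (rule shuffle_sum_minus)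
    finally show ?thesis using slot by (simp add: numeral_2_eq_2)
  qed
  show ?case
  proof (cases n)
    case 0
    then show ?thesis using 2 len by (simp add: assms(1) assms(2)[of "f []" v] shuffle_sum_gt_length)
  next
    case (Suc m)
    have IH: "sgnv (Suc m) (shuffle_sum m (\<lambda>a b. P (f (v # a) # b)) vs) - shuffle_sum 2 (\<lambda>a b. f (v # P a # b)) vs
       = ce br br (\<lambda>zs. f (v # zs)) vs"
      by (rule Cons.IH) (use Cons.prems Suc in auto)
    \<comment> \<open>The list \<open>vs\<close> has \<open>n\<close> entries, so all of them go to
      \<open>f\<close> and \<open>v\<close> alone is left for \<open>P\<close>.\<close>
    have "shuffle_sum n (\<lambda>a b. P (f a # v # b)) vs = br (f vs) v"
      using shuffle_sum_length[of vs "\<lambda>a b. P (f a # v # b)"] len by (simp add: assms(1))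
    then have "shuffle_sum n (\<lambda>a b. P (f a # b)) (v # vs)
        = shuffle_sum m (\<lambda>a b. P (f (v # a) # b)) vs + sgnv n (br (f vs) v)"
      by (simp add: Suc)
    then have "sgnv (Suc n) (shuffle_sum n (\<lambda>a b. P (f a # b)) (v # vs))
        = br v (f vs) - sgnv (Suc m) (shuffle_sum m (\<lambda>a b. P (f (v # a) # b)) vs)"
      by (simp add: Suc sgnv_add sgnv_diff assms(2)[of "f vs" v])
    then show ?thesis unfolding 2 ce.simps IH[symmetric] by simp
  qed
qed simp

text \<open>The sign exponent in \<open>nr\<close> is \<open>(2 - 1) * (n - 1)\<close>. It has the
  parity of \<open>Suc n\<close>, because \<open>1 \<le> n\<close> makes \<open>n - 1\<close> a true
  predecessor; factoring this sign out leaves \<open>ce_eq_shuffle_sums\<close>.\<close>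

lemma nr_eq_ce:
  assumes "\<And>x y. P [x, y] = br x y" "\<And>x y. br x y = - br y x"
    and "length vs = Suc n" "skew n f" "1 \<le> n"
  shows "nr 2 n P f vs = sgnv (Suc n) (ce br br f vs)"
proof -
  have "nr 2 n P f vs = shuffle_sum n (\<lambda>a b. P (f a # b)) vs - sgnv (n - 1) (shuffle_sum 2 (\<lambda>a b. f (P a # b)) vs)"
    using assms(3) by (simp add: nr_def nr_comp_eq_shuffle_sum)
  also have "\<dots> = sgnv (Suc n) (sgnv (Suc n) (shuffle_sum n (\<lambda>a b. P (f a # b)) vs) - shuffle_sum 2 (\<lambda>a b. f (P a # b)) vs)"
    using assms(5) by (cases n) (simp_all add: sgnv_diff)
  finally show ?thesis by (simp only: ce_eq_shuffle_sums[where P = P and br = br, OF assms(1-4)])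
qed

section \<open>Shuffle sums of multiadditive and skew maps\<close>

lemma additive_shuffle_sum_front:
  assumes "\<And>a b. length a = k \<Longrightarrow> length b + k = length zs \<Longrightarrow> additive (\<lambda>x. F x a b)"
  shows "additive (\<lambda>x. shuffle_sum k (F x) zs)"
proof (rule additive.intro)
  fix x y
  have "shuffle_sum k (F (x + y)) zs = shuffle_sum k (\<lambda>a b. F x a b + F y a b) zs"
    by (rule shuffle_sum_cong) (simp add: additive.add[OF assms])
  then show "shuffle_sum k (F (x + y)) zs = shuffle_sum k (F x) zs + shuffle_sum k (F y) zs"
    by (simp add: shuffle_sum_add)
qed

text \<open>The head of the list is an argument of one of the two blocks, and additivity in it holds
  summand by summand. The cases with an empty block are separate because only one block can then
  receive the head.\<close>

lemma multiadditive_shuffle_sum: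
  assumes "k + l = N"
    and "\<And>b. length b = l \<Longrightarrow> multiadditive k (\<lambda>a. F a b)" "\<And>a. length a = k \<Longrightarrow> multiadditive l (F a)"
  shows "multiadditive N (shuffle_sum k F)"
  using assms
proof (induction N arbitrary: k l F)
  case (Suc N)
  consider "k = 0" | "l = 0" "k = Suc N" | k' l' where "k = Suc k'" "l = Suc l'" "N = Suc (k' + l')"
    using Suc.prems(1) by (cases k; cases l) auto
  then show ?case
  proof cases
    case 1
    then show ?thesis using Suc.prems(3)[of "[]"] Suc.prems(1) multiadditive_cong[of "Suc N" "shuffle_sum k F" "F []"]
      by (simp add: shuffle_sum_0)
  next
    case 2
    have "shuffle_sum k F zs = F zs []" if "length zs = k" for zs
      using shuffle_sum_length[of zs F] that by simp
    then have "multiadditive (Suc N) (shuffle_sum k F) \<longleftrightarrow> multiadditive (Suc N) (\<lambda>a. F a [])"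
      unfolding 2(2)[symmetric] by (rule multiadditive_cong)
    then show ?thesis using Suc.prems(2)[of "[]"] 2 by simp
  next
    case (3 k' l')
    have m1: "multiadditive (Suc k') (\<lambda>a. F a b)" if "length b = l" for b
      using Suc.prems(2)[OF that] 3 by simp
    have m2: "multiadditive (Suc l') (F a)" if "length a = k" for a
      using Suc.prems(3)[OF that] 3 by simp
    have "additive (\<lambda>x. shuffle_sum k F (x # zs))" if len: "length zs = N" for zs
    proof -
      have "additive (\<lambda>x. shuffle_sum k' (\<lambda>a b. F (x # a) b) zs)"
        by (rule additive_shuffle_sum_front) (use m1 3 len in simp)
      moreover have "additive (\<lambda>x. shuffle_sum k (\<lambda>a b. F a (x # b)) zs)"
        by (rule additive_shuffle_sum_front) (use m2 3 len in simp)
      ultimately show ?thesis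
        using 3 by (simp add: additive_diff additive_comp[OF additive_sgnv_fun])
    qed
    moreover have "multiadditive N (\<lambda>zs. shuffle_sum k F (x # zs))" for x
    proof -
      have "multiadditive N (shuffle_sum k' (\<lambda>a b. F (x # a) b))"
        by (rule Suc.IH[of k' l]) (use m1 Suc.prems(3)[of "x # _"] 3 in simp_all)
      moreover have "multiadditive N (shuffle_sum k (\<lambda>a b. F a (x # b)))"
        by (rule Suc.IH[of k l']) (use m2 Suc.prems(2)[of "x # _"] 3 in simp_all)
      ultimately have "multiadditive N (\<lambda>zs. shuffle_sum k' (\<lambda>a b. F (x # a) b) zs
          + sgnv k (shuffle_sum k (\<lambda>a b. F a (x # b)) zs))"
        by (intro multiadditive_plus multiadditive_comp[OF additive_sgnv_fun])
      then show ?thesis by (simp only: 3(1) shuffle_sum.simps)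
    qed
    ultimately show ?thesis by simp
  qed
qed simp

text \<open>If the two leading entries lie in one block, skewness in that block applies. If they are
  separated, exchanging them matches the two placements, whose sign exponents \<open>k'\<close> and
  \<open>Suc k'\<close> have opposite parity.\<close>

lemma skew_shuffle_sum:
  assumes "k + l = N"
    and "\<And>b. length b = l \<Longrightarrow> skew k (\<lambda>a. F a b)" "\<And>a. length a = k \<Longrightarrow> skew l (F a)"
  shows "skew N (shuffle_sum k F)"
  using assms
proof (induction N arbitrary: k l F)
  case (Suc N)
  consider "k = 0" | "l = 0" "k = Suc N" | k' l' where "k = Suc k'" "l = Suc l'" "N = Suc (k' + l')"
    using Suc.prems(1) by (cases k; cases l) auto
  then show ?case
  proof cases
    case 1
    then show ?thesis using Suc.prems(3)[of "[]"] Suc.prems(1) skew_cong[of "Suc N" "shuffle_sum k F" "F []"]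
      by (simp add: shuffle_sum_0)
  next
    case 2
    have "shuffle_sum k F zs = F zs []" if "length zs = k" for zs
      using shuffle_sum_length[of zs F] that by simp
    then have "skew (Suc N) (shuffle_sum k F) \<longleftrightarrow> skew (Suc N) (\<lambda>a. F a [])"
      unfolding 2(2)[symmetric] by (rule skew_cong)
    then show ?thesis using Suc.prems(2)[of "[]"] 2 by simp
  next
    case (3 k' l')
    have m1: "skew (Suc k') (\<lambda>a. F a b)" if "length b = l" for b
      using Suc.prems(2)[OF that] 3 by simp
    have m2: "skew (Suc l') (F a)" if "length a = k" for a
      using Suc.prems(3)[OF that] 3 by simp
    have swap: "shuffle_sum k F (x # y # zs) = - shuffle_sum k F (y # x # zs)" if len: "Suc (length zs) = N" for x y zs
    proof -
      have snd_block: "shuffle_sum k (\<lambda>a b. F a (x # y # b)) zs = - shuffle_sum k (\<lambda>a b. F a (y # x # b)) zs"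
      proof (subst shuffle_sum_minus[symmetric], rule shuffle_sum_cong)
        fix a b :: "'a list" assume "length a = k" "length b + k = length zs"
        then show "F a (x # y # b) = - F a (y # x # b)"
          using 3 len by (intro skew_swap[OF Suc.prems(3)]) simp_all
      qed
      show ?thesis
      proof (cases k')
        case 0
        then show ?thesis using snd_block 3 by simp
      next
        case k'': (Suc k'')
        have "shuffle_sum k'' (\<lambda>a b. F (x # y # a) b) zs = - shuffle_sum k'' (\<lambda>a b. F (y # x # a) b) zs"
        proof (subst shuffle_sum_minus[symmetric], rule shuffle_sum_cong)
          fix a b :: "'a list" assume "length a = k''" "length b + k'' = length zs"
          then show "F (x # y # a) b = - F (y # x # a) b"
            using 3 len k'' by (intro skew_swap[OF Suc.prems(2)]) simp_all
        qed
        then show ?thesis using snd_block 3 k'' by (simp add: sgnv_diff sgnv_add)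
      qed
    qed
    have "skew N (\<lambda>zs. shuffle_sum k F (x # zs))" for x
    proof -
      have "skew N (shuffle_sum k' (\<lambda>a b. F (x # a) b))"
        by (rule Suc.IH[of k' l]) (use m1 Suc.prems(3)[of "x # _"] 3 in simp_all)
      moreover have "skew N (shuffle_sum k (\<lambda>a b. F a (x # b)))"
        by (rule Suc.IH[of k l']) (use m2 Suc.prems(2)[of "x # _"] 3 in simp_all)
      ultimately have "skew N (\<lambda>zs. shuffle_sum k' (\<lambda>a b. F (x # a) b) zs
          + sgnv k (shuffle_sum k (\<lambda>a b. F a (x # b)) zs))"
        by (intro skew_plus skew_comp[OF additive_sgnv_fun])
      then show ?thesis by (simp only: 3(1) shuffle_sum.simps)
    qed
    with swap show ?thesis by (rule skew_SucI)
  qed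
qed simp

section \<open>Multilinear alternating maps are multiadditive and skew\<close>

lemma multilin_imp_madd:
  assumes "vector_space sa" "vector_space sb" "multilin sa sb m F"
  shows "multiadditive m F"
  using assms(3)
proof (induction m arbitrary: F)
  case (Suc m)
  have one: "sa 1 x = x" "sb 1 y = y" for x y
    using assms(1,2) by (simp_all add: vector_space_def)
  have ml: "F (xs[i := sa a x + sa b y]) = sb a (F (xs[i := x])) + sb b (F (xs[i := y]))"
    if "length xs = Suc m" "i < Suc m" for xs i a b x y
    using Suc.prems that unfolding multilin_def by blast
  have "additive (\<lambda>x. F (x # zs))" if "length zs = m" for zs
    by (rule additive.intro) (use ml[of "0 # zs" 0 1 _ 1] that in \<open>simp add: one\<close>)
  moreover have "multiadditive m (\<lambda>zs. F (x # zs))" for x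
  proof (rule Suc.IH)
    show "multilin sa sb m (\<lambda>zs. F (x # zs))"
      unfolding multilin_def using ml[of "x # _" "Suc _"] by auto
  qed
  ultimately show ?case by simp
qed simp

text \<open>Polarisation: \<open>F\<close> is expanded at two equal leading entries
  \<open>x + y\<close>.\<close>

lemma alternating_imp_skew:
  assumes "multiadditive m F" "alternating m F"
  shows "skew m F"
  using assms
proof (induction m arbitrary: F)
  case (Suc m)
  have alt: "F xs = 0" if "length xs = Suc m" "i < j" "j < Suc m" "xs ! i = xs ! j" for xs i j
    using Suc.prems(2) that unfolding alternating_def by blast
  have swap: "F (x # y # zs) = - F (y # x # zs)" if len: "Suc (length zs) = m" for x y zs
  proof -
    have diag: "F (z # z # zs) = 0" for z by (rule alt[of _ 0 1]) (use len in auto)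
    have add1: "F ((x + y) # z # zs) = F (x # z # zs) + F (y # z # zs)" for x y z
      by (rule multiadditive_add[OF Suc.prems(1)]) (use len in simp)
    have add2: "F (z # (x + y) # zs) = F (z # x # zs) + F (z # y # zs)" for x y z
      by (rule multiadditive_add[of m "\<lambda>zs. F (z # zs)"]) (use Suc.prems(1) len in simp_all)
    have "0 = F ((x + y) # (x + y) # zs)" by (simp add: diag)
    also have "\<dots> = F (x # (x + y) # zs) + F (y # (x + y) # zs)" by (rule add1)
    also have "\<dots> = F (x # y # zs) + F (y # x # zs)" by (simp add: add2 diag)
    finally show ?thesis by (simp add: eq_neg_iff_add_eq_0)
  qed
  have "skew m (\<lambda>zs. F (x # zs))" for x
  proof (rule Suc.IH)
    show "alternating m (\<lambda>zs. F (x # zs))"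
      unfolding alternating_def using alt[of "x # _" "Suc _" "Suc _"] by auto
  qed (use Suc.prems in simp)
  with swap show ?case by (rule skew_SucI)
qed simp

section \<open>The exponential of the bracket with a square-zero endomorphism\<close>

text \<open>Applies \<open>\<phi>\<close> in \<open>N\<close> slots, summed over all choices of slots: the divided power of
  \<open>slot_sum \<phi>\<close> when \<open>\<phi> \<circ> \<phi> = 0\<close>.\<close>
fun slot_subsets_sum :: "('a \<Rightarrow> 'a) \<Rightarrow> nat \<Rightarrow> ('a list \<Rightarrow> 'b) \<Rightarrow> 'a list \<Rightarrow> 'b::ab_group_add" where
  "slot_subsets_sum \<phi> 0 f ys = f ys"
| "slot_subsets_sum \<phi> (Suc N) f [] = 0"
| "slot_subsets_sum \<phi> (Suc N) f (y # ys) =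
     slot_subsets_sum \<phi> (Suc N) (\<lambda>zs. f (y # zs)) ys + slot_subsets_sum \<phi> N (\<lambda>zs. f (\<phi> y # zs)) ys"

lemma slot_subsets_sum_0: "slot_subsets_sum \<phi> 0 f = f"
  by (rule ext) simp

lemma slot_subsets_sum_gt_length: "length ys < N \<Longrightarrow> slot_subsets_sum \<phi> N f ys = 0"
  by (induction \<phi> N f ys rule: slot_subsets_sum.induct) auto

lemma slot_subsets_sum_zero: "(\<And>zs. length zs = length ys \<Longrightarrow> f zs = 0) \<Longrightarrow> slot_subsets_sum \<phi> N f ys = 0"
  by (induction \<phi> N f ys rule: slot_subsets_sum.induct) auto

text \<open>Multiadditivity expands the right-hand side over the sets of slots that receive
  \<open>\<phi> y\<close>, and \<open>N\<close> sorts these sets by size; sizes above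
  \<open>length ys\<close> contribute 0. For square-zero \<open>\<phi>\<close> this sums the
  exponential series of \<open>slot_sum \<phi>\<close>.\<close>

lemma sum_slot_subsets:
  "multiadditive (length ys) f \<Longrightarrow> length ys \<le> m \<Longrightarrow>
   (\<Sum>N\<le>m. slot_subsets_sum \<phi> N f ys) = f (map (\<lambda>y. y + \<phi> y) ys)"
proof (induction ys arbitrary: f m)
  case Nil
  have "(\<Sum>N\<le>m. slot_subsets_sum \<phi> N f []) = (\<Sum>N\<in>{0}. slot_subsets_sum \<phi> N f [])"
    by (rule sum.mono_neutral_right) (auto simp: slot_subsets_sum_gt_length)
  then show ?case by simp
next
  case (Cons y ys)
  then obtain m' where m: "m = Suc m'" by (cases m) auto
  \<comment> \<open>Applying \<open>\<phi>\<close> to \<open>y\<close> uses up one of the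
    \<open>N\<close> slots, so the second sum is shifted and ends at \<open>m'\<close>.\<close>
  have "(\<Sum>N\<le>m. slot_subsets_sum \<phi> N f (y # ys))
      = (\<Sum>N\<le>m. slot_subsets_sum \<phi> N (\<lambda>zs. f (y # zs)) ys)
        + (\<Sum>N\<le>m'. slot_subsets_sum \<phi> N (\<lambda>zs. f (\<phi> y # zs)) ys)"
    unfolding m by (simp add: sum.atMost_Suc_shift sum.distrib del: sum.atMost_Suc)
  also have "(\<Sum>N\<le>m. slot_subsets_sum \<phi> N (\<lambda>zs. f (y # zs)) ys) = f (y # map (\<lambda>y. y + \<phi> y) ys)"
    by (rule Cons.IH) (use Cons.prems in auto)
  also have "(\<Sum>N\<le>m'. slot_subsets_sum \<phi> N (\<lambda>zs. f (\<phi> y # zs)) ys) = f (\<phi> y # map (\<lambda>y. y + \<phi> y) ys)"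
    by (rule Cons.IH) (use Cons.prems m in auto)
  also have "f (y # map (\<lambda>y. y + \<phi> y) ys) + f (\<phi> y # map (\<lambda>y. y + \<phi> y) ys) = f (map (\<lambda>y. y + \<phi> y) (y # ys))"
    by (simp add: multiadditive_add[OF Cons.prems(1)])
  finally show ?case .
qed

text \<open>Each set of \<open>Suc N\<close> slots arises from \<open>Suc N\<close> choices of the
  slot filled by the outer sum, and filling a slot twice gives
  \<open>\<phi> (\<phi> y) = 0\<close>.\<close>

lemma slot_sum_slot_subsets_sum:
  assumes s: "vector_space s" and nil: "\<And>y. \<phi> (\<phi> y) = 0" and "multiadditive (length ys) f"
  shows "slot_sum \<phi> (slot_subsets_sum \<phi> N f) ys = s (of_nat (Suc N)) (slot_subsets_sum \<phi> (Suc N) f ys)"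
  using assms(3)
proof (induction ys arbitrary: f N)
  case Nil
  interpret vector_space s by (rule s)
  show ?case by simp
next
  case (Cons y ys)
  interpret vector_space s by (rule s)
  have IH: "slot_sum \<phi> (slot_subsets_sum \<phi> N (\<lambda>zs. f (z # zs))) ys
      = s (of_nat (Suc N)) (slot_subsets_sum \<phi> (Suc N) (\<lambda>zs. f (z # zs)) ys)" for z N
    by (rule Cons.IH) (use Cons.prems in simp)
  have zero: "slot_subsets_sum \<phi> N (\<lambda>zs. f (\<phi> (\<phi> y) # zs)) ys = 0" for N
    by (rule slot_subsets_sum_zero) (simp add: nil multiadditive_zero_front[OF Cons.prems])
  show ?case
  proof (cases N)
    case 0
    then show ?thesis using IH[where z = y and N = 0] by (simp add: slot_subsets_sum_0)
  next
    case (Suc M)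
    have two: "s 2 v = v + v" for v
      using scale_left_distrib[of 1 1 v] by simp
    from Suc show ?thesis
      using IH[where z = y and N = N] IH[where z = "\<phi> y" and N = M] zero[of M]
      by (simp add: slot_sum_plus two algebra_simps)
  qed
qed

text \<open>Since \<open>X\<close> has arity 1, the sign exponent in \<open>nr\<close> is
  \<open>(n - 1) * 0\<close>, and the bracket is precomposition minus postcomposition.\<close>

lemma adR_eq_slot_sum:
  assumes "length vs = n" "skew n Y"
  shows "adR X n Y vs = slot_sum (\<lambda>y. X [y]) Y vs - X [Y vs]"
  using assms shuffle_sum_1_eq_slot_sum[of vs Y X] shuffle_sum_length[of vs "\<lambda>a b. X (Y a # b)"]
  by (simp add: adR_def nr_def nr_comp_eq_shuffle_sum)

lemma skew_adR:
  assumes "\<And>v. X [v] = E v" "additive E" "skew n Y"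
  shows "skew n (adR X n Y)"
proof -
  have "skew n (adR X n Y) \<longleftrightarrow> skew n (\<lambda>vs. slot_sum (\<lambda>y. X [y]) Y vs - X [Y vs])"
    by (rule skew_cong) (rule adR_eq_slot_sum[OF _ assms(3)])
  also have \<dots>
    unfolding assms(1) by (rule skew_diff[OF skew_slot_sum[OF assms(3)] skew_comp[OF assms(2,3)]])
  finally show ?thesis .
qed

lemma skew_adR_power:
  assumes "\<And>v. X [v] = E v" "additive E" "skew n Y"
  shows "skew n ((adR X n ^^ N) Y)"
  by (induction N) (simp_all add: assms(3) skew_adR[where X = X and E = E, OF assms(1,2)])

text \<open>\<open>ad\<close> is the difference of precomposition and postcomposition with \<open>E\<close>; these commute, and
  \<open>E (E v) = 0\<close> leaves only the two leading terms of the binomial expansion.\<close>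
lemma adR_power:
  assumes s: "vector_space s"
    and E: "\<And>v. X [v] = E v" "additive E" "\<And>v. E (E v) = 0" "\<And>c v. E (s c v) = s c (E v)"
    and Y: "multiadditive n Y" "skew n Y" and "length vs = n"
  shows "(adR X n ^^ N) Y vs =
    s (fact N) (slot_subsets_sum E N Y vs - (if N = 0 then 0 else E (slot_subsets_sum E (N - 1) Y vs)))"
  using assms(8)
proof (induction N arbitrary: vs)
  case 0
  interpret vector_space s by (rule s)
  show ?case by simp
next
  case (Suc N)
  interpret vector_space s by (rule s)
  let ?S = "\<lambda>N. slot_subsets_sum E N Y"
  let ?a = "\<lambda>N vs. ?S N vs - (if N = 0 then 0 else E (?S (N - 1) vs))"
  have step: "slot_sum E (?S N) vs = s (of_nat (Suc N)) (?S (Suc N) vs)" for N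
    by (rule slot_sum_slot_subsets_sum[where s = s and \<phi> = E, OF s E(3)]) (use Y Suc.prems in simp)
  have add_s: "additive (s c)" for c by (simp add: additive_def scale_right_distrib)
  have "(adR X n ^^ Suc N) Y vs = slot_sum E ((adR X n ^^ N) Y) vs - E ((adR X n ^^ N) Y vs)"
    using adR_eq_slot_sum[OF Suc.prems skew_adR_power[where X = X and E = E, OF E(1,2) Y(2)]] by (simp add: E(1))
  also have "slot_sum E ((adR X n ^^ N) Y) vs = slot_sum E (\<lambda>vs. s (fact N) (?a N vs)) vs"
    by (rule slot_sum_cong) (simp add: Suc)
  also have "\<dots> = s (fact N) (slot_sum E (?S N) vs - (if N = 0 then 0 else E (slot_sum E (?S (N - 1)) vs)))"
    by (simp add: slot_sum_additive[OF add_s] slot_sum_diff slot_sum_additive[OF E(2)] slot_sum_zero additive.zero[OF E(2)])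
  also have "\<dots> = s (fact N) (s (of_nat (Suc N)) (?S (Suc N) vs) - s (of_nat N) (E (?S N vs)))"
    by (cases N) (simp_all add: step E(4))
  \<comment> \<open>\<open>E (E v) = 0\<close> removes the second term. What remains joins the
    \<open>N\<close> copies of \<open>E (?S N vs)\<close> from the slot sum to give
    \<open>Suc N\<close>, the factor between \<open>fact N\<close> and
    \<open>fact (Suc N)\<close>.\<close>
  also have "E ((adR X n ^^ N) Y vs) = s (fact N) (E (?S N vs))"
    by (simp add: Suc E additive.diff[OF E(2)] additive.zero[OF E(2)])
  finally show ?case
    by (simp add: algebra_simps)
qed

section \<open>The differential of a relative difference Lie algebra\<close>

lemma lift_g_eq_shuffle_sum:
  "length vs = k + l \<Longrightarrow> lift_g k l \<kappa> vs = shuffle_sum k (\<lambda>a b. (\<kappa> (map fst a) (map snd b), 0)) vs"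
  unfolding lift_g_def by (rule sum_shuffles_eq_shuffle_sum)

lemma lift_h_eq_shuffle_sum:
  "length vs = k + l \<Longrightarrow> lift_h k l \<kappa> vs = shuffle_sum k (\<lambda>a b. (0, \<kappa> (map fst a) (map snd b))) vs"
  unfolding lift_h_def by (rule sum_shuffles_eq_shuffle_sum)

lemma additive_fst: "additive fst" and additive_snd: "additive snd"
  and additive_Pair_0: "additive (\<lambda>x. (x, 0))" and additive_0_Pair: "additive (Pair 0)"
  by (simp_all add: additive_def)

lemma multiadditive_lift_h:
  fixes \<kappa> :: "'a::ab_group_add list \<Rightarrow> 'b::ab_group_add list \<Rightarrow> 'b"
  assumes "k + l = N" "\<And>us. length us = l \<Longrightarrow> multiadditive k (\<lambda>xs. \<kappa> xs us)" "\<And>xs. length xs = k \<Longrightarrow> multiadditive l (\<kappa> xs)"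
  shows "multiadditive N (lift_h k l \<kappa>)"
proof -
  let ?F = "\<lambda>a b. (0 :: 'a, \<kappa> (map fst a) (map snd b))"
  have "multiadditive N (lift_h k l \<kappa>) \<longleftrightarrow> multiadditive N (shuffle_sum k ?F)"
    by (rule multiadditive_cong) (simp add: lift_h_eq_shuffle_sum assms(1))
  moreover have "multiadditive N (shuffle_sum k ?F)"
  proof (rule multiadditive_shuffle_sum[OF assms(1)])
    show "multiadditive k (\<lambda>a. (0, \<kappa> (map fst a) (map snd b)))" if "length b = l" for b :: "('a \<times> 'b) list"
      by (rule multiadditive_comp[OF additive_0_Pair multiadditive_map[OF additive_fst assms(2)]]) (simp add: that)
    show "multiadditive l (\<lambda>b. (0, \<kappa> (map fst a) (map snd b)))" if "length a = k" for a :: "('a \<times> 'b) list"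
      by (rule multiadditive_comp[OF additive_0_Pair multiadditive_map[OF additive_snd assms(3)]]) (simp add: that)
  qed
  ultimately show ?thesis by (rule iffD2)
qed

lemma skew_lift_h:
  fixes \<kappa> :: "'a::ab_group_add list \<Rightarrow> 'b::ab_group_add list \<Rightarrow> 'b"
  assumes "k + l = N" "\<And>us. length us = l \<Longrightarrow> skew k (\<lambda>xs. \<kappa> xs us)" "\<And>xs. length xs = k \<Longrightarrow> skew l (\<kappa> xs)"
  shows "skew N (lift_h k l \<kappa>)"
proof -
  let ?F = "\<lambda>a b. (0 :: 'a, \<kappa> (map fst a) (map snd b))"
  have "skew N (lift_h k l \<kappa>) \<longleftrightarrow> skew N (shuffle_sum k ?F)"
    by (rule skew_cong) (simp add: lift_h_eq_shuffle_sum assms(1))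
  moreover have "skew N (shuffle_sum k ?F)"
  proof (rule skew_shuffle_sum[OF assms(1)])
    show "skew k (\<lambda>a. (0, \<kappa> (map fst a) (map snd b)))" if "length b = l" for b :: "('a \<times> 'b) list"
      by (rule skew_comp[OF additive_0_Pair skew_map[OF assms(2)]]) (simp add: that)
    show "skew l (\<lambda>b. (0, \<kappa> (map fst a) (map snd b)))" if "length a = k" for a :: "('a \<times> 'b) list"
      by (rule skew_comp[OF additive_0_Pair skew_map[OF assms(3)]]) (simp add: that)
  qed
  ultimately show ?thesis by (rule iffD2)
qed

lemma shuffle_sum_full: "length vs = n \<Longrightarrow> shuffle_sum n F vs = F vs []"
  using shuffle_sum_length[of vs F] by simp

lemma lift_g_0: "length vs = n \<Longrightarrow> lift_g n 0 (\<lambda>xs _. f xs) vs = (f (map fst vs), 0)"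
  by (subst lift_g_eq_shuffle_sum) (simp_all add: shuffle_sum_full)

lemma lift_h_0: "length vs = n \<Longrightarrow> lift_h n 0 (\<lambda>xs _. f xs) vs = (0, f (map fst vs))"
  by (subst lift_h_eq_shuffle_sum) (simp_all add: shuffle_sum_full)

lemma multiadditive_lift_g_0:
  fixes f :: "'a::ab_group_add list \<Rightarrow> 'a"
  assumes "multiadditive n f"
  shows "multiadditive n (lift_g n 0 (\<lambda>xs _. f xs) :: ('a \<times> 'b::ab_group_add) list \<Rightarrow> _)"
proof -
  have "multiadditive n (lift_g n 0 (\<lambda>xs _. f xs) :: ('a \<times> 'b) list \<Rightarrow> _)
      \<longleftrightarrow> multiadditive n (\<lambda>vs :: ('a \<times> 'b) list. (f (map fst vs), 0 :: 'b))"
    by (rule multiadditive_cong) (rule lift_g_0)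
  moreover have "multiadditive n (\<lambda>vs :: ('a \<times> 'b) list. (f (map fst vs), 0 :: 'b))"
    by (rule multiadditive_comp[OF additive_Pair_0 multiadditive_map[OF additive_fst assms]])
  ultimately show ?thesis by (rule iffD2)
qed

lemma skew_lift_g_0:
  fixes f :: "'a::ab_group_add list \<Rightarrow> 'a"
  assumes "skew n f"
  shows "skew n (lift_g n 0 (\<lambda>xs _. f xs) :: ('a \<times> 'b::ab_group_add) list \<Rightarrow> _)"
proof -
  have "skew n (lift_g n 0 (\<lambda>xs _. f xs) :: ('a \<times> 'b) list \<Rightarrow> _)
      \<longleftrightarrow> skew n (\<lambda>vs :: ('a \<times> 'b) list. (f (map fst vs), 0 :: 'b))"
    by (rule skew_cong) (rule lift_g_0)
  moreover have "skew n (\<lambda>vs :: ('a \<times> 'b) list. (f (map fst vs), 0 :: 'b))"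
    by (rule skew_comp[OF additive_Pair_0 skew_map[OF assms]])
  ultimately show ?thesis by (rule iffD2)
qed

section \<open>Additivity of the bracket in its argument of arity two\<close>

lemma nr_2_eq:
  "length vs = Suc k \<Longrightarrow> nr 2 k Y T vs = shuffle_sum k (\<lambda>a b. Y (T a # b)) vs
     - sgnv (k - 1) (shuffle_sum 2 (\<lambda>a b. T (Y a # b)) vs)"
  by (simp add: nr_def nr_comp_eq_shuffle_sum)

lemma nr_2_cong:
  assumes "length vs = Suc k" "\<And>zs. length zs = 2 \<Longrightarrow> Y zs = Z zs"
  shows "nr 2 k Y T vs = nr 2 k Z T vs"
proof -
  have "shuffle_sum k (\<lambda>a b. Y (T a # b)) vs = shuffle_sum k (\<lambda>a b. Z (T a # b)) vs"
    by (rule shuffle_sum_cong) (use assms in auto)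
  moreover have "shuffle_sum 2 (\<lambda>a b. T (Y a # b)) vs = shuffle_sum 2 (\<lambda>a b. T (Z a # b)) vs"
    by (rule shuffle_sum_cong) (use assms in auto)
  ultimately show ?thesis by (simp add: nr_2_eq assms(1))
qed

lemma nr_2_add:
  assumes "multiadditive k T" "length vs = Suc k"
  shows "nr 2 k (\<lambda>zs. Y zs + Z zs) T vs = nr 2 k Y T vs + nr 2 k Z T vs"
proof -
  have "shuffle_sum 2 (\<lambda>a b. T ((Y a + Z a) # b)) vs = shuffle_sum 2 (\<lambda>a b. T (Y a # b) + T (Z a # b)) vs"
  proof (rule shuffle_sum_cong)
    fix a b :: "'a list" assume "length b + 2 = length vs"
    then have "k = Suc (length b)" using assms(2) by simp
    then show "T ((Y a + Z a) # b) = T (Y a # b) + T (Z a # b)"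
      using assms(1) by (simp add: additive.add[of "\<lambda>x. T (x # b)"])
  qed
  then show ?thesis by (simp add: nr_2_eq assms(2) shuffle_sum_add sgnv_add)
qed

lemma nr_2_sum:
  assumes "multiadditive k T" "length vs = Suc k"
  shows "nr 2 k (\<lambda>zs. \<Sum>i\<le>m. Y i zs) T vs = (\<Sum>i\<le>(m::nat). nr 2 k (Y i) T vs)"
  by (induction m) (simp_all add: nr_2_add[OF assms])

text \<open>Additivity of \<open>T\<close> lets natural multiples through the bracket; the scalars
  to be moved are the factorials of the exponential series.\<close>

lemma nr_2_scale_of_nat:
  assumes "vector_space s" "multiadditive k T" "length vs = Suc k"
  shows "nr 2 k (\<lambda>zs. s (of_nat j) (Y zs)) T vs = s (of_nat j) (nr 2 k Y T vs)"
proof (induction j)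
  case 0
  interpret vector_space s by (rule assms(1))
  \<comment> \<open>The bracket with the zero map equals twice itself, hence vanishes.\<close>
  show ?case using nr_2_add[OF assms(2,3), of "\<lambda>_. 0" "\<lambda>_. 0"] by simp
next
  case (Suc j)
  interpret vector_space s by (rule assms(1))
  show ?case using Suc nr_2_add[OF assms(2,3), of Y "\<lambda>zs. s (of_nat j) (Y zs)"]
    by (simp add: scale_left_distrib)
qed

lemma vector_space_scaleV:
  "vector_space sg \<Longrightarrow> vector_space sh \<Longrightarrow> vector_space (scaleV sg sh)"
  by (auto simp: vector_space_def scaleV_def)

text \<open>\<open>a N\<close> is the term of order \<open>N\<close> of the exponential series, and
  the total is a conjugation: precomposition with \<open>1 + E\<close> in every slot,
  postcomposition with its inverse \<open>1 - E\<close>. The series stops at \<open>Suc n\<close>,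
  because \<open>E\<close> can enter each of the \<open>n\<close> slots and the output at most
  once.\<close>

lemma exp_ad:
  fixes s :: "'k::field_char_0 \<Rightarrow> 'g::ab_group_add \<times> 'h::ab_group_add \<Rightarrow> 'g \<times> 'h"
  assumes s: "vector_space s"
    and E: "\<And>v. X [v] = E v" "additive E" "\<And>v. E (E v) = 0" "\<And>c v. E (s c v) = s c (E v)"
    and Y: "multiadditive n Y" "skew n Y"
  obtains a where
    "\<And>N vs. length vs = n \<Longrightarrow> (adR X n ^^ N) Y vs = s (fact N) (a N vs)"
    "\<And>N vs. length vs = n \<Longrightarrow> Suc n < N \<Longrightarrow> a N vs = 0"
    "\<And>vs. length vs = n \<Longrightarrow> (\<Sum>N\<le>Suc n. a N vs)
       = Y (map (\<lambda>v. v + E v) vs) - E (Y (map (\<lambda>v. v + E v) vs))"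
proof -
  let ?S = "\<lambda>N. slot_subsets_sum E N Y"
  define a where "a N vs = ?S N vs - (if N = 0 then 0 else E (?S (N - 1) vs))" for N vs
  have 1: "(adR X n ^^ N) Y vs = s (fact N) (a N vs)" if "length vs = n" for N vs
    unfolding a_def by (rule adR_power[where X = X and E = E and s = s, OF s E Y that])
  have 2: "a N vs = 0" if "length vs = n" "Suc n < N" for N vs
    using that by (simp add: a_def slot_subsets_sum_gt_length additive.zero[OF E(2)])
  have 3: "(\<Sum>N\<le>Suc n. a N vs) = Y (map (\<lambda>v. v + E v) vs) - E (Y (map (\<lambda>v. v + E v) vs))"
    if len: "length vs = n" for vs
  proof -
    have total: "(\<Sum>N\<le>m. ?S N vs) = Y (map (\<lambda>v. v + E v) vs)" if "n \<le> m" for m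
      by (rule sum_slot_subsets) (use Y len that in auto)
    have "(\<Sum>N\<le>Suc n. a N vs) = (\<Sum>N\<le>Suc n. ?S N vs) - (\<Sum>N\<le>Suc n. if N = 0 then 0 else E (?S (N - 1) vs))"
      by (simp only: a_def sum_subtractf)
    also have "(\<Sum>N\<le>Suc n. if N = 0 then 0 else E (?S (N - 1) vs)) = (\<Sum>N\<le>n. E (?S N vs))"
      by (simp add: sum.atMost_Suc_shift del: sum.atMost_Suc)
    also have "\<dots> = E (\<Sum>N\<le>n. ?S N vs)"
      by (simp add: additive.sum[OF E(2)])
    finally show ?thesis by (simp add: total del: sum.atMost_Suc)
  qed
  show thesis by (rule that[of a]; fact 1 2 3)
qed

section \<open>Lie identities, the semidirect product and the twisted action\<close>

locale difference_lie =
  fixes sg :: "'k::field_char_0 \<Rightarrow> 'g::ab_group_add \<Rightarrow> 'g"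
    and sh :: "'k \<Rightarrow> 'h::ab_group_add \<Rightarrow> 'h"
    and bg :: "'g \<Rightarrow> 'g \<Rightarrow> 'g" and bh :: "'h \<Rightarrow> 'h \<Rightarrow> 'h"
    and \<rho> :: "'g \<Rightarrow> 'h \<Rightarrow> 'h" and D :: "'g \<Rightarrow> 'h"
  assumes rel_diff_lie: "rel_diff_lie sg bg sh bh \<rho> D"
begin

lemma vector_spaces: "vector_space sg" "vector_space sh" "vector_space (scaleV sg sh)"
  using rel_diff_lie by (auto simp: rel_diff_lie_def lie_algebra_def vector_space_scaleV)

lemma scale_1: "sg 1 x = x" "sh 1 u = u"
  using vector_spaces by (simp_all add: vector_space_def)

lemma bg_bilinear: "bg (sg a x + sg b y) z = sg a (bg x z) + sg b (bg y z)"
    "bg z (sg a x + sg b y) = sg a (bg z x) + sg b (bg z y)"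
  and bh_bilinear: "bh (sh a u + sh b v) w = sh a (bh u w) + sh b (bh v w)"
    "bh w (sh a u + sh b v) = sh a (bh w u) + sh b (bh w v)"
  and \<rho>_linear: "\<rho> (sg a x + sg b y) u = sh a (\<rho> x u) + sh b (\<rho> y u)"
  and \<rho>_add: "\<rho> x (u + v) = \<rho> x u + \<rho> x v"
  and bg_self: "bg x x = 0" and bh_self: "bh u u = 0"
  and bg_jacobi: "bg x (bg y z) + bg y (bg z x) + bg z (bg x y) = 0"
  and bh_jacobi: "bh u (bh v w) + bh v (bh w u) + bh w (bh u v) = 0"
  and \<rho>_derivation: "\<rho> x (bh u v) = bh (\<rho> x u) v + bh u (\<rho> x v)"
  and \<rho>_bracket: "\<rho> (bg x y) u = \<rho> x (\<rho> y u) - \<rho> y (\<rho> x u)"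
  and D_add: "D (x + y) = D x + D y" and D_scale: "D (sg a x) = sh a (D x)"
  and D_bracket: "D (bg x y) = \<rho> x (D y) - \<rho> y (D x) + bh (D x) (D y)"
  using rel_diff_lie
  by (simp_all add: rel_diff_lie_def lie_algebra_def lie_action_def linear_iff)

lemma bg_add: "bg (x + y) z = bg x z + bg y z" "bg z (x + y) = bg z x + bg z y"
  and bh_add: "bh (u + v) w = bh u w + bh v w" "bh w (u + v) = bh w u + bh w v"
  and \<rho>_add_left: "\<rho> (x + y) u = \<rho> x u + \<rho> y u"
  using bg_bilinear[where a = 1 and b = 1] bh_bilinear[where a = 1 and b = 1] \<rho>_linear[where a = 1 and b = 1] by (simp_all add: scale_1)

lemma additives: "additive (bg x)" "additive (\<lambda>x. bg x y)" "additive (bh u)" "additive (\<lambda>u. bh u v)"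
  "additive (\<rho> x)" "additive (\<lambda>x. \<rho> x u)" "additive D"
  by (simp_all add: additive_def bg_add bh_add \<rho>_add \<rho>_add_left D_add)

lemmas diffs = additives[THEN additive.diff]
lemmas minuses = additives[THEN additive.minus]
lemmas zeros = additives[THEN additive.zero]

lemma bg_skew: "bg x y = - bg y x"
proof -
  have "0 = bg (x + y) (x + y)" by (simp only: bg_self)
  also have "\<dots> = bg x y + bg y x" unfolding bg_add by (simp add: bg_self)
  finally show ?thesis by (simp add: eq_neg_iff_add_eq_0)
qed

lemma bh_skew: "bh u v = - bh v u"
proof -
  have "0 = bh (u + v) (u + v)" by (simp only: bh_self)
  also have "\<dots> = bh u v + bh v u" unfolding bh_add by (simp add: bh_self)
  finally show ?thesis by (simp add: eq_neg_iff_add_eq_0)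
qed

lemma bg_leibniz: "bg x (bg y z) = bg (bg x y) z + bg y (bg x z)"
proof -
  have 1: "bg y (bg z x) = - bg y (bg x z)"
    by (simp only: bg_skew[of z x] minuses)
  have 2: "bg z (bg x y) = - bg (bg x y) z"
    by (rule bg_skew)
  show ?thesis
    using bg_jacobi[of x y z] unfolding 1 2 by (simp add: algebra_simps)
qed

lemma bh_leibniz: "bh u (bh v w) = bh (bh u v) w + bh v (bh u w)"
proof -
  have 1: "bh v (bh w u) = - bh v (bh u w)"
    by (simp only: bh_skew[of w u] minuses)
  have 2: "bh w (bh u v) = - bh (bh u v) w"
    by (rule bh_skew)
  show ?thesis
    using bh_jacobi[of u v w] unfolding 1 2 by (simp add: algebra_simps)
qed

definition semidirect :: "'g \<times> 'h \<Rightarrow> 'g \<times> 'h \<Rightarrow> 'g \<times> 'h" where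
  "semidirect v w = (bg (fst v) (fst w), \<rho> (fst v) (snd w) - \<rho> (fst w) (snd v) + bh (snd v) (snd w))"

definition twisted_action :: "'g \<Rightarrow> 'h \<Rightarrow> 'h" where
  "twisted_action x u = \<rho> x u + bh (D x) u"

lemma semidirect_skew: "semidirect v w = - semidirect w v"
  by (simp add: semidirect_def bg_skew[of "fst v"] bh_skew[of "snd v"])

lemma semidirect_anticommute: "semidirect v w + semidirect w v = 0"
  using semidirect_skew[of v w] by simp

text \<open>This is the adjoint representation. Its Leibniz identity combines the Jacobi identities
  of \<gg> and \<hh> with the fact that \<rho> is a homomorphism into derivations.\<close>

sublocale semidirect: lie_module semidirect semidirect
proof
  have leibniz: "semidirect x (semidirect y z) = semidirect (semidirect x y) z + semidirect y (semidirect x z)"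
    for x y z
    by (simp add: semidirect_def prod_eq_iff bg_leibniz[of "fst x"] \<rho>_add \<rho>_derivation \<rho>_bracket
        bh_add diffs bh_leibniz[of "snd x"] bh_skew[of "snd y" "\<rho> (fst z) (snd x)"] algebra_simps)
  show "semidirect x (semidirect y z) = semidirect (semidirect x y) z + semidirect y (semidirect x z)"
    for x y z by (rule leibniz)
  show "semidirect (semidirect x y) m = semidirect x (semidirect y m) - semidirect y (semidirect x m)" for x y m
    using leibniz[of x y m] by simp
  show "semidirect x y = - semidirect y x" for x y by (rule semidirect_skew)
qed (simp_all add: additive_def semidirect_def bg_add \<rho>_add \<rho>_add_left bh_add)

text \<open>By \<open>D_bracket\<close>, the bracket with \<open>D (bg x y)\<close> splits into
  those with \<open>\<rho> x (D y)\<close>, \<open>- \<rho> y (D x)\<close> and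
  \<open>bh (D x) (D y)\<close>. The first two are the mixed commutators, by the derivation
  property, and the third is the commutator of two inner derivations.\<close>

sublocale twisted: lie_module bg twisted_action
proof
  show "twisted_action (bg x y) m = twisted_action x (twisted_action y m) - twisted_action y (twisted_action x m)"
    for x y m
    by (simp add: twisted_action_def \<rho>_add \<rho>_derivation \<rho>_bracket D_bracket bh_add diffs
        bh_leibniz[of "D x" "D y"] bh_skew[of "D y" "\<rho> _ _"] algebra_simps)
  show "bg x y = - bg y x" and "bg x (bg y z) = bg (bg x y) z + bg y (bg x z)" for x y z
    by (rule bg_skew bg_leibniz)+
qed (simp_all add: additive_def twisted_action_def bg_add \<rho>_add \<rho>_add_left bh_add D_add algebra_simps)

section \<open>Twisting by \<open>D\<close> and projecting onto the maps from \<gg> to \<hh>\<close>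

definition E :: "'g \<times> 'h \<Rightarrow> 'g \<times> 'h" where
  "E v = (0, D (fst v))"

lemma additive_E: "additive E"
  by (simp add: additive_def E_def D_add)

lemma E_E: "E (E v) = 0"
  by (simp add: E_def zeros prod_eq_iff)

lemma E_scale: "E (scaleV sg sh c v) = scaleV sg sh c (E v)"
proof -
  interpret sg: vector_space sg by (rule vector_spaces)
  show ?thesis by (simp add: E_def scaleV_def D_scale)
qed

lemma DL_eq: "DL D [v] = E v"
  by (simp add: DL_def E_def lift_h_0)

lemma PiL_eq: "PiL bg bh \<rho> [v, w] = semidirect v w"
  by (simp add: PiL_def lift_g_eq_shuffle_sum lift_h_eq_shuffle_sum semidirect_def numeral_2_eq_2)

lemma multiadditive_PiL: "multiadditive 2 (PiL bg bh \<rho>)" and skew_PiL: "skew 2 (PiL bg bh \<rho>)"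
  by (auto simp: numeral_2_eq_2 length_Suc_conv PiL_eq semidirect.br_additive semidirect.br_additive_left
      semidirect_anticommute)

lemma projF_scale: "scaleV sg sh c (projF Y vs) = projF (\<lambda>ws. scaleV sg sh c (Y ws)) vs"
proof -
  interpret sg: vector_space sg by (rule vector_spaces)
  show ?thesis by (simp add: projF_def scaleV_def)
qed

lemma projF_sum: "(\<Sum>N\<in>A. projF (Y N) vs) = projF (\<lambda>ws. \<Sum>N\<in>A. Y N ws) vs"
  by (induction A rule: infinite_finite_induct) (auto simp: projF_def zero_prod_def)

lemma scale_inverse_fact: "scaleV sg sh (1 / fact N) (scaleV sg sh (fact N) v) = v"
proof -
  interpret vector_space "scaleV sg sh" by (rule vector_spaces)
  show ?thesis by simp
qed

lemma projF_zero: "Y (map (\<lambda>v. (fst v, 0)) vs) = 0 \<Longrightarrow> projF Y vs = 0"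
  by (simp add: projF_def zero_prod_def)

text \<open>By \<open>exp_ad\<close> the terms beyond \<open>Suc n\<close> vanish, so the formal
  series is a finite sum, and \<open>1 / fact N\<close> cancels the factorial there. The projection
  evaluates on arguments from \<gg> and is additive, so it can be taken after summing.\<close>

lemma projF_exp_ad:
  assumes "multiadditive n Y" "skew n Y" "length vs = n"
  shows "Sum_any (\<lambda>N. scaleV sg sh (1 / fact N) (projF ((adR (DL D) n ^^ N) Y) vs))
    = projF (\<lambda>ws. Y (map (\<lambda>v. v + E v) ws) - E (Y (map (\<lambda>v. v + E v) ws))) vs"
proof -
  obtain a where a:
    "\<And>N vs. length vs = n \<Longrightarrow> (adR (DL D) n ^^ N) Y vs = scaleV sg sh (fact N) (a N vs)"
    "\<And>N vs. length vs = n \<Longrightarrow> Suc n < N \<Longrightarrow> a N vs = 0"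
    "\<And>vs. length vs = n \<Longrightarrow> (\<Sum>N\<le>Suc n. a N vs)
       = Y (map (\<lambda>v. v + E v) vs) - E (Y (map (\<lambda>v. v + E v) vs))"
    using exp_ad[OF vector_spaces(3), where X = "DL D" and E = E, OF DL_eq additive_E E_E E_scale assms(1,2)] by blast
  have summand: "scaleV sg sh (1 / fact N) (projF ((adR (DL D) n ^^ N) Y) vs) = projF (a N) vs" for N
    using assms(3) by (simp add: projF_scale) (simp add: projF_def a(1) scale_inverse_fact)
  have "Sum_any (\<lambda>N. projF (a N) vs) = (\<Sum>N\<le>Suc n. projF (a N) vs)"
  proof (rule Sum_any.expand_superset)
    have "projF (a N) vs = 0" if "Suc n < N" for N
      by (rule projF_zero) (use a(2) assms(3) that in simp)
    then show "{N. projF (a N) vs \<noteq> 0} \<subseteq> {..Suc n}" by (auto simp flip: not_less)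
  qed simp
  also have "\<dots> = projF (\<lambda>ws. Y (map (\<lambda>v. v + E v) ws) - E (Y (map (\<lambda>v. v + E v) ws))) vs"
    unfolding projF_sum using a(3) assms(3) by (simp add: projF_def del: sum.atMost_Suc)
  finally show ?thesis by (simp add: summand)
qed

text \<open>\<open>\<Pi>\<close> twisted by \<open>exp (ad D)\<close>, that is, conjugated by \<open>1 + E\<close>.\<close>
definition twisted_bracket :: "'g \<times> 'h \<Rightarrow> 'g \<times> 'h \<Rightarrow> 'g \<times> 'h" where
  "twisted_bracket v w = semidirect (v + E v) (w + E w) - E (semidirect (v + E v) (w + E w))"

text \<open>The bracket is additive in its first argument, so the series is summed inside it, where
  \<open>exp_ad\<close> turns \<Pi> into \<open>twisted_bracket\<close>; \<open>nr_eq_ce\<close>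
  then makes the bracket a differential. The last index is \<open>Suc 2\<close>, for two inputs and
  one output of \<Pi>.\<close>

lemma projF_nr_exp_ad:
  assumes "multiadditive k T" "skew k T" "1 \<le> k" "length vs = Suc k"
  shows "Sum_any (\<lambda>N. scaleV sg sh (1 / fact N) (projF (nr 2 k ((adR (DL D) 2 ^^ N) (PiL bg bh \<rho>)) T) vs))
    = projF (\<lambda>ws. sgnv (Suc k) (ce twisted_bracket twisted_bracket T ws)) vs"
proof -
  let ?\<Pi> = "PiL bg bh \<rho>"
  interpret vector_space "scaleV sg sh" by (rule vector_spaces)
  obtain a where a:
    "\<And>N vs. length vs = 2 \<Longrightarrow> (adR (DL D) 2 ^^ N) ?\<Pi> vs = scaleV sg sh (fact N) (a N vs)"
    "\<And>N vs. length vs = 2 \<Longrightarrow> Suc 2 < N \<Longrightarrow> a N vs = 0"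
    "\<And>vs. length vs = 2 \<Longrightarrow> (\<Sum>N\<le>Suc 2. a N vs)
       = ?\<Pi> (map (\<lambda>v. v + E v) vs) - E (?\<Pi> (map (\<lambda>v. v + E v) vs))"
    using exp_ad[OF vector_spaces(3), where X = "DL D" and E = E, OF DL_eq additive_E E_E E_scale multiadditive_PiL skew_PiL] by blast
  have scaled: "nr 2 k ((adR (DL D) 2 ^^ N) ?\<Pi>) T ws = scaleV sg sh (fact N) (nr 2 k (a N) T ws)"
    if "length ws = Suc k" for N ws
  proof -
    have "nr 2 k ((adR (DL D) 2 ^^ N) ?\<Pi>) T ws = nr 2 k (\<lambda>zs. scaleV sg sh (fact N) (a N zs)) T ws"
      by (rule nr_2_cong[OF that]) (rule a(1))
    then show ?thesis
      using nr_2_scale_of_nat[OF vector_spaces(3) assms(1) that, where j = "fact N" and Y = "a N"] by simp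
  qed
  have summand: "scaleV sg sh (1 / fact N) (projF (nr 2 k ((adR (DL D) 2 ^^ N) ?\<Pi>) T) vs) = projF (nr 2 k (a N) T) vs" for N
    using assms(4) by (simp add: projF_scale) (simp add: projF_def scaled scale_inverse_fact)
  have vanish: "nr 2 k (a N) T ws = 0" if "Suc 2 < N" "length ws = Suc k" for N ws
  proof -
    \<comment> \<open>Zero is written as a multiple by \<open>of_nat 0\<close>, so that the rule for
      natural multiples gives the vanishing.\<close>
    have "nr 2 k (a N) T ws = nr 2 k (\<lambda>_. scaleV sg sh (of_nat 0) 0) T ws"
      by (rule nr_2_cong[OF that(2)]) (simp add: a(2)[OF _ that(1)])
    also have "\<dots> = scaleV sg sh (of_nat 0) (nr 2 k (\<lambda>_. 0) T ws)"
      by (rule nr_2_scale_of_nat[OF vector_spaces(3) assms(1) that(2)])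
    finally show ?thesis by simp
  qed
  have "Sum_any (\<lambda>N. projF (nr 2 k (a N) T) vs) = (\<Sum>N\<le>Suc 2. projF (nr 2 k (a N) T) vs)"
  proof (rule Sum_any.expand_superset)
    have "projF (nr 2 k (a N) T) vs = 0" if "Suc 2 < N" for N
      by (rule projF_zero) (use vanish assms(4) that in simp)
    then show "{N. projF (nr 2 k (a N) T) vs \<noteq> 0} \<subseteq> {..Suc 2}" by (auto simp flip: not_less)
  qed simp
  also have "\<dots> = projF (nr 2 k (\<lambda>zs. \<Sum>N\<le>Suc 2. a N zs) T) vs"
    unfolding projF_sum using assms(4) by (simp add: projF_def nr_2_sum[OF assms(1)] del: sum.atMost_Suc)
  also have "\<dots> = projF (\<lambda>ws. sgnv (Suc k) (ce twisted_bracket twisted_bracket T ws)) vs"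
  proof -
    have "nr 2 k (\<lambda>zs. \<Sum>N\<le>Suc 2. a N zs) T ws = sgnv (Suc k) (ce twisted_bracket twisted_bracket T ws)"
      if "length ws = Suc k" for ws
    proof (rule nr_eq_ce[OF _ _ that assms(2,3)])
      show "(\<Sum>N\<le>Suc 2. a N [v, w]) = twisted_bracket v w" for v w
        using a(3)[of "[v, w]"] by (simp add: PiL_eq twisted_bracket_def del: sum.atMost_Suc)
      show "twisted_bracket v w = - twisted_bracket w v" for v w
        unfolding twisted_bracket_def semidirect_skew[of "v + E v"]
        by (simp add: additive.minus[OF additive_E])
    qed
    then show ?thesis using assms(4) by (simp add: projF_def del: sum.atMost_Suc)
  qed
  finally show ?thesis by (simp add: summand)
qed

section \<open>The graph of \<open>D\<close>, the projection along it, and the components of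
  \<delta>\<close>

definition graph :: "'g \<Rightarrow> 'g \<times> 'h" where
  "graph x = (x, D x)"

text \<open>The projection of the direct sum onto \<hh> along the graph of \<open>D\<close>. It
  equals \<open>snd (v - E v)\<close>, which is how it arises from the twisting.\<close>

definition defect :: "'g \<times> 'h \<Rightarrow> 'h" where
  "defect v = snd v - D (fst v)"

lemma additive_defect: "additive defect"
  by (simp add: additive_def defect_def D_add)

text \<open>\<open>D_bracket\<close> enters twice: it makes \<open>graph\<close> a Lie homomorphism
  into the semidirect product, and it makes \<open>defect\<close> carry the adjoint action of
  \<open>graph x\<close> to \<open>twisted_action x\<close>.\<close>

lemma defect_ce:
  "defect (ce semidirect semidirect f (map graph xs)) = ce bg twisted_action (\<lambda>zs. defect (f (map graph zs))) xs"
  by (rule ce_natural[OF additive_defect])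
     (simp_all add: semidirect_def graph_def defect_def twisted_action_def D_bracket bh_add diffs)

text \<open>On pairs \<open>(x, 0)\<close>, \<open>(y, 0)\<close> the twisted bracket has no
  component in \<hh>, which is the Maurer--Cartan equation for \<open>D\<close>; hence
  \<open>x \<mapsto> (x, 0)\<close> is compatible with the brackets. The action of
  \<open>(x, 0)\<close> on the second component is \<open>twisted_action x\<close>.\<close>

lemma snd_ce_twisted_bracket:
  "snd (ce twisted_bracket twisted_bracket f (map (\<lambda>x. (x, 0)) xs))
   = ce bg twisted_action (\<lambda>zs. snd (f (map (\<lambda>x. (x, 0)) zs))) xs"
  by (rule ce_natural[OF additive_snd])
     (simp_all add: twisted_bracket_def semidirect_def E_def twisted_action_def D_bracket bh_add \<rho>_add diffs)

text \<open>The exponent \<open>n\<close> and the minus sign in \<open>delta\<close> together cancel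
  the exponent \<open>Suc n\<close> of \<open>nr_eq_ce\<close>.\<close>

lemma fst_delta:
  assumes "skew n \<Phi>" "1 \<le> n" "length vs = Suc n"
  shows "fst (delta sg sh bg bh \<rho> D n (\<Phi>, T)) vs = ce semidirect semidirect \<Phi> vs"
  using nr_eq_ce[where P = "PiL bg bh \<rho>" and br = semidirect, OF PiL_eq semidirect_skew assms(3,1,2)] by (simp add: delta_def Let_def)

text \<open>On arguments \<open>(x, 0)\<close> the map \<open>1 + E\<close> is \<open>graph\<close>,
  and \<open>snd\<close> after \<open>1 - E\<close> is \<open>defect\<close>. The bracket with
  \<open>T\<close>, of arity \<open>n - 1\<close>, carries the sign exponent \<open>n\<close>, which
  cancels that of \<open>delta\<close>; the term from \<open>\<Phi>\<close> keeps its sign.\<close>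

lemma snd_delta:
  assumes "multiadditive n \<Phi>" "skew n \<Phi>" "multiadditive (n - 1) T" "skew (n - 1) T" "1 \<le> n" "length vs = n"
  shows "snd (delta sg sh bg bh \<rho> D n (\<Phi>, T)) vs =
    (0, sgnv n (defect (\<Phi> (map graph (map fst vs))))
       + (if 2 \<le> n then ce bg twisted_action (\<lambda>zs. snd (T (map (\<lambda>x. (x, 0)) zs))) (map fst vs) else 0))"
proof -
  have 1: "projF (\<lambda>ws. \<Phi> (map (\<lambda>v. v + E v) ws) - E (\<Phi> (map (\<lambda>v. v + E v) ws))) vs
      = (0, defect (\<Phi> (map graph (map fst vs))))"
    by (simp add: projF_def E_def defect_def graph_def comp_def)
  have 2: "projF (\<lambda>ws. sgnv n (ce twisted_bracket twisted_bracket T ws)) vs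
      = (0, sgnv n (ce bg twisted_action (\<lambda>zs. snd (T (map (\<lambda>x. (x, 0)) zs))) (map fst vs)))"
    using snd_ce_twisted_bracket[of T "map fst vs"] by (simp add: projF_def snd_sgnv comp_def)
  have Pair_sgnv: "sgnv k (0, u) = (0, sgnv k u)" for k and u :: 'h
    by (simp add: sgnv_def)
  have 3: "Sum_any (\<lambda>N. scaleV sg sh (1 / fact N) (projF (nr 2 (n - Suc 0) ((adR (DL D) 2 ^^ N) (PiL bg bh \<rho>)) T) vs))
      = projF (\<lambda>ws. sgnv n (ce twisted_bracket twisted_bracket T ws)) vs" if "2 \<le> n"
    using projF_nr_exp_ad[OF assms(3,4)] that assms(6) by simp
  show ?thesis
    by (simp add: delta_def Let_def projF_exp_ad[OF assms(1,2,6)] 1 2 3 Pair_sgnv sgnv_add)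
qed

text \<open>Write q for the pullback to the graph followed by \<open>defect\<close>. The
  differential sends \<open>(\<Phi>, t)\<close> to \<open>d \<Phi>\<close> and
  \<open>(-1)^n q \<Phi> + d t\<close>. Applied twice, it leaves \<open>d d \<Phi>\<close>,
  \<open>d d t\<close> and the mixed terms
  \<open>(-1)^(n+1) q (d \<Phi>) + (-1)^n d (q \<Phi>)\<close>, which cancel by
  \<open>defect_ce\<close>.\<close>

lemma delta_delta:
  assumes \<Phi>: "multiadditive n \<Phi>" "skew n \<Phi>" and T: "multiadditive (n - 1) T" "skew (n - 1) T" and n: "1 \<le> n"
  defines "c2 \<equiv> delta sg sh bg bh \<rho> D (n + 1) (delta sg sh bg bh \<rho> D n (\<Phi>, T))"
  shows "length vs = n + 2 \<Longrightarrow> fst c2 vs = 0" and "length vs = n + 1 \<Longrightarrow> snd c2 vs = 0"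
proof -
  define \<Phi>1 where "\<Phi>1 = fst (delta sg sh bg bh \<rho> D n (\<Phi>, T))"
  define T1 where "T1 = snd (delta sg sh bg bh \<rho> D n (\<Phi>, T))"
  have c2: "c2 = delta sg sh bg bh \<rho> D (n + 1) (\<Phi>1, T1)"
    by (simp add: c2_def \<Phi>1_def T1_def)
  let ?d = "ce semidirect semidirect" and ?dt = "ce bg twisted_action"
  define t where "t = (\<lambda>zs. snd (T (map (\<lambda>x. (x, 0)) zs)))"
  define q where "q = (\<lambda>xs. defect (\<Phi> (map graph xs)))"
  define F where "F = (\<lambda>xs. sgnv n (q xs) + (if 2 \<le> n then ?dt t xs else 0))"
  have \<Phi>1: "\<Phi>1 ws = ?d \<Phi> ws" if "length ws = Suc n" for ws
    unfolding \<Phi>1_def by (rule fst_delta[OF \<Phi>(2) n that])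
  have T1: "T1 ws = (0, F (map fst ws))" if "length ws = n" for ws
    unfolding T1_def F_def q_def t_def by (rule snd_delta[OF \<Phi> T n that])
  have graph: "additive graph"
    by (simp add: additive_def graph_def D_add)
  have t: "multiadditive (n - 1) t" "skew (n - 1) t"
    unfolding t_def by (rule multiadditive_comp[OF additive_snd multiadditive_map[OF additive_Pair_0 T(1)]]
        skew_comp[OF additive_snd skew_map[OF T(2)]])+
  have q: "multiadditive n q" "skew n q"
    unfolding q_def by (rule multiadditive_comp[OF additive_defect multiadditive_map[OF graph \<Phi>(1)]]
        skew_comp[OF additive_defect skew_map[OF \<Phi>(2)]])+
  have "multiadditive n (?dt t)" "skew n (?dt t)"
    using twisted.multiadditive_d[OF t(1)] twisted.skew_d[OF t] n by simp_all
  then have F: "multiadditive n F" "skew n F"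
    unfolding F_def by (cases "2 \<le> n"; simp add: q multiadditive_plus skew_plus
        multiadditive_comp[OF additive_sgnv_fun] skew_comp[OF additive_sgnv_fun])+
  \<comment> \<open>The explicit formulas for \<open>\<Phi>1\<close> and \<open>T1\<close> hold on
    lists of the right length, so the properties needed for the second application of
    \<open>delta\<close> are transferred by congruence.\<close>
  have "multiadditive (Suc n) \<Phi>1 \<longleftrightarrow> multiadditive (Suc n) (?d \<Phi>)"
    by (rule multiadditive_cong) (rule \<Phi>1)
  moreover have "skew (Suc n) \<Phi>1 \<longleftrightarrow> skew (Suc n) (?d \<Phi>)"
    by (rule skew_cong) (rule \<Phi>1)
  ultimately have \<Phi>1_props: "multiadditive (n + 1) \<Phi>1" "skew (n + 1) \<Phi>1"
    unfolding Suc_eq_plus1[symmetric] using semidirect.multiadditive_d[OF \<Phi>(1)] semidirect.skew_d[OF \<Phi>] by blast+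
  have "multiadditive n T1 \<longleftrightarrow> multiadditive n (\<lambda>ws :: ('g \<times> 'h) list. (0 :: 'g, F (map fst ws)))"
    by (rule multiadditive_cong) (rule T1)
  moreover have "skew n T1 \<longleftrightarrow> skew n (\<lambda>ws :: ('g \<times> 'h) list. (0 :: 'g, F (map fst ws)))"
    by (rule skew_cong) (rule T1)
  ultimately have T1_props: "multiadditive n T1" "skew n T1"
    using multiadditive_comp[OF additive_0_Pair multiadditive_map[OF additive_fst F(1)]] skew_comp[OF additive_0_Pair skew_map[OF F(2)]]
    by blast+
  show "fst c2 vs = 0" if "length vs = n + 2"
  proof -
    have "fst c2 vs = ?d \<Phi>1 vs"
      unfolding c2 by (rule fst_delta) (use \<Phi>1_props that in auto)
    also have "\<dots> = ?d (?d \<Phi>) vs"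
      by (rule ce_cong) (use \<Phi>1 that in auto)
    also have "\<dots> = 0"
      by (rule semidirect.d_d) (use \<Phi> that in simp)
    finally show ?thesis .
  qed
  show "snd c2 vs = 0" if len: "length vs = n + 1"
  proof -
    let ?xs = "map fst vs"
    \<comment> \<open>Now the degree is \<open>n + 1 \<ge> 2\<close>, so the term from
      \<open>T1\<close> is always present.\<close>
    have "snd c2 vs = (0, sgnv (n + 1) (defect (\<Phi>1 (map graph ?xs))) + ?dt (\<lambda>zs. snd (T1 (map (\<lambda>x. (x, 0)) zs))) ?xs)"
      unfolding c2 by (subst snd_delta) (use \<Phi>1_props T1_props len n in auto)
    also have "\<Phi>1 (map graph ?xs) = ?d \<Phi> (map graph ?xs)"
      by (rule \<Phi>1) (use len in simp)
    also have "defect (?d \<Phi> (map graph ?xs)) = ?dt q ?xs"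
      unfolding q_def by (rule defect_ce)
    also have "?dt (\<lambda>zs. snd (T1 (map (\<lambda>x. (x, 0)) zs))) ?xs = ?dt F ?xs"
      by (rule ce_cong) (use len T1 in \<open>simp add: comp_def\<close>)
    \<comment> \<open>For \<open>n = 1\<close> the map \<open>F\<close> is the signed pullback
      alone; otherwise the extra term is \<open>d d t = 0\<close>. What is left cancels the term of
      sign exponent \<open>n + 1\<close>.\<close>
    also have "\<dots> = sgnv n (?dt q ?xs)"
    proof (cases "2 \<le> n")
      case True
      have "?dt (?dt t) ?xs = 0"
        by (rule twisted.d_d) (use t len in simp)
      then show ?thesis
        using True by (simp add: F_def ce_plus[OF twisted.act_additive] ce_sgnv[OF twisted.act_additive])
    qed (simp add: F_def ce_sgnv[OF twisted.act_additive])
    finally show ?thesis by (simp add: prod_eq_iff)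
  qed
qed

end

section \<open>Cochains given by multilinear alternating maps\<close>

theorem theorem3p10:
  fixes sg :: "'k::field_char_0 \<Rightarrow> 'g::ab_group_add \<Rightarrow> 'g"
    and sh :: "'k \<Rightarrow> 'h::ab_group_add \<Rightarrow> 'h"
    and bg :: "'g \<Rightarrow> 'g \<Rightarrow> 'g" and bh :: "'h \<Rightarrow> 'h \<Rightarrow> 'h"
    and \<rho> :: "'g \<Rightarrow> 'h \<Rightarrow> 'h" and D :: "'g \<Rightarrow> 'h"
    and n :: nat
    and fg :: "'g list \<Rightarrow> 'g"
    and fh :: "nat \<Rightarrow> 'g list \<Rightarrow> 'h list \<Rightarrow> 'h"
    and \<theta> :: "'g list \<Rightarrow> 'h"
  assumes "rel_diff_lie sg bg sh bh \<rho> D"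
    and "1 \<le> n"
    and "multilin sg sg n fg" and "alternating n fg"
    and "\<forall>i\<in>{1..n}. hom2 sg sh sh (n - i) i (fh i)"
    and "multilin sg sh (n - 1) \<theta>" and "alternating (n - 1) \<theta>"
    and "n = 1 \<longrightarrow> (\<forall>xs. \<theta> xs = 0)"
  shows "(let c2 = delta sg sh bg bh \<rho> D (n + 1) (delta sg sh bg bh \<rho> D n (cochain n fg fh \<theta>))
          in (\<forall>vs. length vs = n + 2 \<longrightarrow> fst c2 vs = 0) \<and>
             (\<forall>vs. length vs = n + 1 \<longrightarrow> snd c2 vs = 0))"
proof -
  interpret difference_lie sg sh bg bh \<rho> D by standard (rule assms(1))
  have fg: "multiadditive n fg" "skew n fg"
    using multilin_imp_madd[OF vector_spaces(1,1) assms(3)] alternating_imp_skew assms(4) by blast+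
  have \<theta>: "multiadditive (n - 1) \<theta>" "skew (n - 1) \<theta>"
    using multilin_imp_madd[OF vector_spaces(1,2) assms(6)] alternating_imp_skew assms(7) by blast+
  have fh: "multiadditive (n - i) (\<lambda>xs. fh i xs us)" "skew (n - i) (\<lambda>xs. fh i xs us)"
    if "i \<in> {1..n}" "length us = i" for i us
  proof -
    have "multilin sg sh (n - i) (\<lambda>xs. fh i xs us)" "alternating (n - i) (\<lambda>xs. fh i xs us)"
      using assms(5) that by (auto simp: hom2_def)
    then show "multiadditive (n - i) (\<lambda>xs. fh i xs us)" "skew (n - i) (\<lambda>xs. fh i xs us)"
      using multilin_imp_madd[OF vector_spaces(1,2)] alternating_imp_skew by blast+
  qed
  have fh': "multiadditive i (fh i xs)" "skew i (fh i xs)" if "i \<in> {1..n}" "length xs = n - i" for i xs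
  proof -
    have "multilin sh sh i (fh i xs)" "alternating i (fh i xs)"
      using assms(5) that by (auto simp: hom2_def)
    then show "multiadditive i (fh i xs)" "skew i (fh i xs)"
      using multilin_imp_madd[OF vector_spaces(2,2)] alternating_imp_skew by blast+
  qed
  let ?\<Phi> = "\<lambda>vs. lift_g n 0 (\<lambda>xs _. fg xs) vs + (\<Sum>i = 1..n. lift_h (n - i) i (fh i) vs)"
  \<comment> \<open>The lifts merge the conditions on the two blocks of arguments into conditions on
    all \<open>n\<close> arguments in the direct sum.\<close>
  have \<Phi>: "multiadditive n ?\<Phi>"
    by (intro multiadditive_plus multiadditive_sum multiadditive_lift_g_0 multiadditive_lift_h fg fh fh') auto
  have \<Phi>': "skew n ?\<Phi>"
    by (intro skew_plus skew_sum skew_lift_g_0 skew_lift_h fg fh fh') auto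
  have T: "multiadditive (n - 1) (lift_h (n - 1) 0 (\<lambda>xs _. \<theta> xs))" "skew (n - 1) (lift_h (n - 1) 0 (\<lambda>xs _. \<theta> xs))"
    using \<theta> by (intro multiadditive_lift_h skew_lift_h; simp)+
  show ?thesis
    unfolding cochain_def Let_def using delta_delta[OF \<Phi> \<Phi>' T assms(2)] by blast
qed

end
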